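(* Assume that $K$ is injective with dense range and that $(\delta_{ij})_{i,j\in\mathbb{N}}$ are independent and identically distributed with zero mean and bounded variance. Moreover assume that $(l_j)_{j\in\mathbb{N}}$ is complete and square-summable. Then for $\alpha_{m,n}$ determined by the discrepancy principle described in the context there holds $$\lim_{\substack{m\to\infty\\ n\to\infty\\ m/n\to 0}}\mathbb{P}\left(\left\|R^{(m)}_{\alpha_{m,n}}\bar{Y}^{(m)}_n-K^+\hat{y}\right\|\ge \varepsilon\right)=0$$ for all $\varepsilon>0$.
   Context: $\mathcal{X},\mathcal{Y}$ are real Hilbert spaces, $K:\mathcal{X}\to\mathcal{Y}$ is a compact linear operator, $K^+$ is its generalised (Moore-Penrose) inverse with domain $\mathcal{D}(K^+)$, and $\hat y\in\mathcal{D}(K^+)$. Measurement channels: $(l_j)_{j\in\mathbb{N}}$ are continuous linear functionals on $\mathcal{Y}$ with $\|l_1\|=\|l_2\|=\dots$. Put $P_m:\mathcal{Y}\to\mathbb{R}^m$, $P_my=(l_1(y),\dots,l_m(y))^T$; it is assumed that $P_mP_m^*$ is bijective for every $m$. Complete means: for every $y\in\mathcal{Y}\setminus\{0\}$ there is $j$ with $l_j(y)\ne0$. Square-summable means: $\sum_{j=1}^\infty l_j(y)^2<\infty$ for every $y\in\mathcal{Y}$. Measurements: $Y_{ij}=l_j(\hat y)+\delta_{ij}$ with real random errors $\delta_{ij}$, and $\bar Y^{(m)}_n=\frac1n\sum_{i=1}^n(Y_{i1},\dots,Y_{im})^T\in\mathbb{R}^m$. Tikhonov regularisation: for $v\in\mathbb{R}^m$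 and $\alpha>0$, $R^{(m)}_\alpha v$ is the unique minimiser over $x\in\mathcal{X}$ of $\|P_mKx-v\|_{\mathbb{R}^m}^2+\alpha\|x\|_{\mathcal{X}}^2$. Estimated noise level: $\delta^{est}_{m,n}=\sqrt{\frac mn s_{m,n}^2}$ with $s^2_{m,n}=\frac1m\sum_{j=1}^m\frac1{n-1}\sum_{i=1}^n\big(Y_{ij}-\frac1n\sum_{l=1}^nY_{lj}\big)^2$. Discrepancy principle: fix $\tau>1$ and $q\in(0,1)$. Starting from $k=0$, increase $k$ by one as long as $\|P_mKR^{(m)}_{q^k}\bar Y_n^{(m)}-\bar Y_n^{(m)}\|>\tau\,\delta^{est}_{m,n}$; then set $\alpha_{m,n}=q^k$ for the resulting $k$, i.e. for the smallest $k\in\{0,1,2,\dots\}$ with $\|P_mKR^{(m)}_{q^k}\bar Y_n^{(m)}-\bar Y_n^{(m)}\|\le\tau\,\delta^{est}_{m,n}$. *)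

theory Defs
  imports "HOL-Probability.Probability"
begin

text \<open>
  Real Hilbert spaces are types of class \<open>{real_inner, complete_space}\<close>.  Since the dimension
  of the measurement space varies, a vector of $R^m$ is a sequence \<open>nat \<Rightarrow> real\<close> that vanishes from
  index \<open>m\<close> on, with norm \<open>L2_set v {..<m}\<close>.  Channels and repetitions are numbered from \<open>0\<close>.
\<close>

definition compact_operator :: "('a::real_normed_vector \<Rightarrow> 'b::real_normed_vector) \<Rightarrow> bool" where
  "compact_operator K \<longleftrightarrow> linear K \<and> (\<forall>S. bounded S \<longrightarrow> compact (closure (K ` S)))"

definition pinv_domain :: "('a::real_inner \<Rightarrow> 'b::real_inner) \<Rightarrow> 'b set" where
  "pinv_domain K = {u + v | u v. u \<in> range K \<and> v \<in> (range K)\<^sup>\<bottom>}"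

text \<open>
  The Moore-Penrose inverse is the linear extension to \<open>pinv_domain K\<close>, with kernel
  \<open>(range K)\<^sup>\<bottom>\<close>, of the inverse of the bijection that \<open>K\<close> induces from \<open>(ker K)\<^sup>\<bottom>\<close> onto \<open>range K\<close>.
  It is meaningful on \<open>pinv_domain K\<close> only.
\<close>

definition pinv :: "('a::real_inner \<Rightarrow> 'b::real_inner) \<Rightarrow> 'b \<Rightarrow> 'a" where
  "pinv K y = (THE x. x \<in> (K -` {0})\<^sup>\<bottom> \<and> y - K x \<in> (range K)\<^sup>\<bottom>)"

lemma pinv_eqI:
  assumes K: "linear K" and x: "x \<in> (K -` {0})\<^sup>\<bottom>" and r: "y - K x \<in> (range K)\<^sup>\<bottom>"
  shows "pinv K y = x"
  unfolding pinv_def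
proof (rule the_equality)
  show "x \<in> (K -` {0})\<^sup>\<bottom> \<and> y - K x \<in> (range K)\<^sup>\<bottom>"
    using x r by simp
next
  fix z assume z: "z \<in> (K -` {0})\<^sup>\<bottom> \<and> y - K z \<in> (range K)\<^sup>\<bottom>"
  have "(y - K z) - (y - K x) \<in> (range K)\<^sup>\<bottom>"
    using z r by (simp only: subspace_diff[OF subspace_orthogonal_comp])
  moreover have "(y - K z) - (y - K x) = K (x - z)"
    by (simp add: linear_diff[OF K])
  ultimately have "K (x - z) \<in> (range K)\<^sup>\<bottom>" by simp
  then have "inner (K (x - z)) (K (x - z)) = 0"
    unfolding orthogonal_comp_def orthogonal_def by blast
  then have "x - z \<in> K -` {0}" by simp
  moreover have "x - z \<in> (K -` {0})\<^sup>\<bottom>"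
    using z x by (simp only: subspace_diff[OF subspace_orthogonal_comp])
  ultimately have "inner (x - z) (x - z) = 0"
    unfolding orthogonal_comp_def orthogonal_def by blast
  then show "z = x" by simp
qed

definition coord_space :: "nat \<Rightarrow> (nat \<Rightarrow> real) set" where
  "coord_space m = {v. \<forall>j\<ge>m. v j = 0}"

definition channel_op :: "(nat \<Rightarrow> 'b \<Rightarrow> real) \<Rightarrow> nat \<Rightarrow> 'b \<Rightarrow> nat \<Rightarrow> real" where
  "channel_op l m y = (\<lambda>j. if j < m then l j y else 0)"

text \<open>The Hilbert space adjoint of \<open>channel_op l m\<close>, for the inner product of $R^m$.\<close>

definition channel_adj :: "(nat \<Rightarrow> 'b::real_inner \<Rightarrow> real) \<Rightarrow> nat \<Rightarrow> (nat \<Rightarrow> real) \<Rightarrow> 'b" where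
  "channel_adj l m a = (THE z. \<forall>y. inner z y = (\<Sum>j<m. a j * channel_op l m y j))"

definition residual ::
  "(nat \<Rightarrow> 'b \<Rightarrow> real) \<Rightarrow> ('a \<Rightarrow> 'b) \<Rightarrow> nat \<Rightarrow> (nat \<Rightarrow> real) \<Rightarrow> 'a \<Rightarrow> real" where
  "residual l K m v x = L2_set (\<lambda>j. channel_op l m (K x) j - v j) {..<m}"

definition tikhonov_minimiser ::
  "(nat \<Rightarrow> 'b \<Rightarrow> real) \<Rightarrow> ('a::real_normed_vector \<Rightarrow> 'b) \<Rightarrow> nat \<Rightarrow> real \<Rightarrow> (nat \<Rightarrow> real) \<Rightarrow> 'a" where
  "tikhonov_minimiser l K m \<alpha> v =
     (THE x. is_arg_min (\<lambda>x. (residual l K m v x)\<^sup>2 + \<alpha> * (norm x)\<^sup>2) (\<lambda>_. True) x)"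

text \<open>
  For \<open>\<alpha> > 0\<close> this is the minimiser.  The value at \<open>\<alpha> = 0\<close>, its limit as \<open>\<alpha>\<close> decreases to \<open>0\<close>,
  matters only when the discrepancy principle below does not stop.
\<close>

definition tikhonov ::
  "(nat \<Rightarrow> 'b \<Rightarrow> real) \<Rightarrow> ('a::real_normed_vector \<Rightarrow> 'b) \<Rightarrow> nat \<Rightarrow> real \<Rightarrow> (nat \<Rightarrow> real) \<Rightarrow> 'a" where
  "tikhonov l K m \<alpha> v =
     (if \<alpha> > 0 then tikhonov_minimiser l K m \<alpha> v
      else Lim (at_right 0) (\<lambda>a. tikhonov_minimiser l K m a v))"

definition meas ::
  "(nat \<Rightarrow> 'b \<Rightarrow> real) \<Rightarrow> 'b \<Rightarrow> (nat \<Rightarrow> nat \<Rightarrow> 'w \<Rightarrow> real) \<Rightarrow> nat \<Rightarrow> nat \<Rightarrow> 'w \<Rightarrow> real" where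
  "meas l y \<delta> i j \<omega> = l j y + \<delta> i j \<omega>"

definition meas_mean ::
  "(nat \<Rightarrow> 'b \<Rightarrow> real) \<Rightarrow> 'b \<Rightarrow> (nat \<Rightarrow> nat \<Rightarrow> 'w \<Rightarrow> real) \<Rightarrow> nat \<Rightarrow> nat \<Rightarrow> 'w \<Rightarrow> nat \<Rightarrow> real" where
  "meas_mean l y \<delta> m n \<omega> =
     (\<lambda>j. if j < m then 1 / real n * (\<Sum>i<n. meas l y \<delta> i j \<omega>) else 0)"

definition sample_var ::
  "(nat \<Rightarrow> 'b \<Rightarrow> real) \<Rightarrow> 'b \<Rightarrow> (nat \<Rightarrow> nat \<Rightarrow> 'w \<Rightarrow> real) \<Rightarrow> nat \<Rightarrow> nat \<Rightarrow> 'w \<Rightarrow> real" where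
  "sample_var l y \<delta> m n \<omega> =
     1 / real m * (\<Sum>j<m. 1 / (real n - 1) *
       (\<Sum>i<n. (meas l y \<delta> i j \<omega> - 1 / real n * (\<Sum>k<n. meas l y \<delta> k j \<omega>))\<^sup>2))"

definition noise_est ::
  "(nat \<Rightarrow> 'b \<Rightarrow> real) \<Rightarrow> 'b \<Rightarrow> (nat \<Rightarrow> nat \<Rightarrow> 'w \<Rightarrow> real) \<Rightarrow> nat \<Rightarrow> nat \<Rightarrow> 'w \<Rightarrow> real" where
  "noise_est l y \<delta> m n \<omega> = sqrt (real m / real n * sample_var l y \<delta> m n \<omega>)"

definition discrepancy_stop ::
  "(nat \<Rightarrow> 'b \<Rightarrow> real) \<Rightarrow> ('a::real_normed_vector \<Rightarrow> 'b) \<Rightarrow> nat \<Rightarrow> real \<Rightarrow> real \<Rightarrow> real \<Rightarrow>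
    (nat \<Rightarrow> real) \<Rightarrow> nat \<Rightarrow> bool" where
  "discrepancy_stop l K m \<tau> q d v k \<longleftrightarrow> residual l K m v (tikhonov l K m (q ^ k) v) \<le> \<tau> * d"

text \<open>
  If the estimated noise level \<open>d\<close> is \<open>0\<close> (as for errors with zero variance), the iteration
  need not stop.  The parameter is then the limit \<open>0\<close> of the powers \<open>q ^ k\<close>.
\<close>

definition discrepancy_alpha ::
  "(nat \<Rightarrow> 'b \<Rightarrow> real) \<Rightarrow> ('a::real_normed_vector \<Rightarrow> 'b) \<Rightarrow> nat \<Rightarrow> real \<Rightarrow> real \<Rightarrow> real \<Rightarrow>
    (nat \<Rightarrow> real) \<Rightarrow> real" where
  "discrepancy_alpha l K m \<tau> q d v =
     (if \<exists>k. discrepancy_stop l K m \<tau> q d v k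
      then q ^ (LEAST k. discrepancy_stop l K m \<tau> q d v k) else 0)"

definition joint_limit :: "(nat \<times> nat) filter" where
  "joint_limit = inf (sequentially \<times>\<^sub>F sequentially)
     (filtercomap (\<lambda>(m, n). real m / real n) (nhds 0))"

lemma eventually_joint_limit:
  "eventually P joint_limit \<longleftrightarrow>
     (\<exists>N. \<exists>c>0. \<forall>m\<ge>N. \<forall>n\<ge>N. real m / real n < c \<longrightarrow> P (m, n))"
proof
  assume "eventually P joint_limit"
  then obtain Q R where Q: "eventually Q (sequentially \<times>\<^sub>F sequentially)"
    and R: "eventually R (filtercomap (\<lambda>(m, n). real m / real n) (nhds 0))"
    and QR: "\<And>x. Q x \<Longrightarrow> R x \<Longrightarrow> P x"
    unfolding joint_limit_def eventually_inf by blast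
  from Q obtain N where N: "\<And>m n. m \<ge> N \<Longrightarrow> n \<ge> N \<Longrightarrow> Q (m, n)"
    unfolding eventually_prod_sequentially by blast
  from R obtain c where c: "c > 0" "\<And>m n. real m / real n < c \<Longrightarrow> R (m, n)"
    unfolding eventually_filtercomap eventually_nhds_metric dist_real_def by fastforce
  show "\<exists>N. \<exists>c>0. \<forall>m\<ge>N. \<forall>n\<ge>N. real m / real n < c \<longrightarrow> P (m, n)"
    using N c QR by blast
next
  assume "\<exists>N. \<exists>c>0. \<forall>m\<ge>N. \<forall>n\<ge>N. real m / real n < c \<longrightarrow> P (m, n)"
  then obtain N c where c: "c > 0"
    and P: "\<And>m n. m \<ge> N \<Longrightarrow> n \<ge> N \<Longrightarrow> real m / real n < c \<Longrightarrow> P (m, n)" by blast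
  have "eventually (\<lambda>(m, n). m \<ge> N \<and> n \<ge> N) (sequentially \<times>\<^sub>F sequentially)"
    unfolding eventually_prod_sequentially by auto
  moreover have "eventually (\<lambda>r. r < c) (nhds 0)"
    using c eventually_nhds_in_open[of "{..<c}" 0] by simp
  then have "eventually (\<lambda>(m, n). real m / real n < c)
      (filtercomap (\<lambda>(m, n). real m / real n) (nhds 0))"
    unfolding eventually_filtercomap by (intro exI[of _ "\<lambda>r. r < c"]) auto
  ultimately show "eventually P joint_limit"
    unfolding joint_limit_def eventually_inf using P by fastforce
qed

end

theory Submission
  imports Defs
begin

text \<open>
  On the event that the noise is at most \<open>\<tau>0\<close> times its estimate \<open>d\<close>, for a fixed \<open>1 < \<tau>0 < \<tau>\<close>, and that
  the estimate is small, the convergence is deterministic.  The regularised solution \<open>z\<close> has a small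
  residual, so it suffices that its norm is asymptotically at most that of the exact solution
  \<open>x\<close>, that is, that \<open>d\<^sup>2 / \<alpha>\<close> tends to \<open>0\<close>.  Minimality at the previous parameter \<open>\<alpha> / q\<close>, where the
  residual still exceeds \<open>\<tau> d\<close>, gives
  \<open>(\<tau>\<^sup>2 - \<tau>0\<^sup>2) d\<^sup>2 \<le> \<alpha> / q * (\<parallel>x\<parallel>\<^sup>2 - \<parallel>y\<parallel>\<^sup>2)\<close> for its minimiser \<open>y\<close>.  Hence
  \<open>\<parallel>y\<parallel> \<le> \<parallel>x\<parallel>\<close>, and since the residual of \<open>y\<close> is at most that of \<open>z\<close> divided by \<open>q\<close>, \<open>y\<close> converges
  to \<open>x\<close>; then the same inequality yields the claim.

  The event has probability tending to \<open>1\<close>: the squared noise and its squared estimate differ only by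
  sums of the mixed products of errors in the same channel.  These products are orthogonal, so second moments
  suffice to show that their sum is negligible against the sum of squares.
\<close>


section \<open>Minimisation in Hilbert space\<close>

text \<open>Strong convexity takes the place of weak compactness: a midpoint cannot fall below the
  infimum, so the gain \<open>c * (norm (x - y))^2\<close> forces a minimising sequence to be
  Cauchy.\<close>

lemma midpoint_convex_attains_min:
  fixes f :: "'a::{real_normed_vector, complete_space} \<Rightarrow> real"
  assumes S: "closed S" "S \<noteq> {}" and cont: "continuous_on S f" and bdd: "bdd_below (f ` S)"
    and c: "c > 0"
    and mid: "\<And>x y. x \<in> S \<Longrightarrow> y \<in> S \<Longrightarrow> (1/2) *\<^sub>R (x + y) \<in> S"
    and conv: "\<And>x y. x \<in> S \<Longrightarrow> y \<in> S \<Longrightarrow>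
      f ((1/2) *\<^sub>R (x + y)) + c * (norm (x - y))\<^sup>2 \<le> (f x + f y) / 2"
  obtains x where "x \<in> S" "\<And>y. y \<in> S \<Longrightarrow> f x \<le> f y"
proof -
  define I where "I = Inf (f ` S)"
  have I_le: "I \<le> f x" if "x \<in> S" for x
    unfolding I_def using that bdd by (intro cInf_lower) auto
  have "\<exists>x\<in>S. f x < I + 1 / real (Suc n)" for n
    using cInf_lessD[of "f ` S" "I + 1 / real (Suc n)"] S(2) unfolding I_def by auto
  then obtain s where s: "\<And>n. s n \<in> S" "\<And>n. f (s n) < I + 1 / real (Suc n)" by metis
  have close: "c * (norm (s n - s p))\<^sup>2 \<le> 1 / real (Suc N)" if "N \<le> n" "N \<le> p" for N n p
  proof -
    have "f (s k) \<le> I + 1 / real (Suc N)" if "N \<le> k" for k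
    proof -
      have "1 / real (Suc k) \<le> 1 / real (Suc N)" using that by (simp add: field_simps)
      then show ?thesis using s(2)[of k] by linarith
    qed
    from this[OF that(1)] this[OF that(2)] show ?thesis
      using conv[OF s(1)[of n] s(1)[of p]] I_le[OF mid[OF s(1)[of n] s(1)[of p]]] by argo
  qed
  have "Cauchy s"
    unfolding Cauchy_iff
  proof (intro allI impI)
    fix e :: real assume e: "0 < e"
    then obtain N where N: "1 / real (Suc N) < c * e\<^sup>2"
      using nat_approx_posE[of "c * e\<^sup>2"] c by auto
    have "norm (s n - s p) < e" if "N \<le> n" "N \<le> p" for n p
    proof -
      have "c * (norm (s n - s p))\<^sup>2 < c * e\<^sup>2" using close[OF that] N by linarith
      then have "(norm (s n - s p))\<^sup>2 < e\<^sup>2" using c by simp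
      then show ?thesis using e by (simp add: power_less_imp_less_base)
    qed
    then show "\<exists>N. \<forall>n\<ge>N. \<forall>p\<ge>N. norm (s n - s p) < e" by blast
  qed
  then obtain x where x: "s \<longlonglongrightarrow> x" using Cauchy_convergent convergent_def by blast
  have xS: "x \<in> S" using closed_sequentially[OF S(1) _ x] s(1) by blast
  have "(\<lambda>n. f (s n)) \<longlonglongrightarrow> f x"
    using continuous_on_tendsto_compose[OF cont x xS] s(1) by simp
  moreover have "(\<lambda>n. I + 1 / real (Suc n)) \<longlonglongrightarrow> I + 0"
    by (intro tendsto_intros LIMSEQ_Suc[OF lim_1_over_n])
  ultimately have "f x \<le> I + 0"
    by (rule LIMSEQ_le) (use s(2) less_imp_le in blast)
  then show ?thesis using that xS I_le by fastforce
qed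

lemma parallelogram_midpoint:
  fixes x y :: "'a::real_inner"
  shows "(norm ((1/2) *\<^sub>R (x + y)))\<^sup>2 + 1/4 * (norm (x - y))\<^sup>2 = ((norm x)\<^sup>2 + (norm y)\<^sup>2) / 2"
  unfolding power2_norm_eq_inner by (simp add: inner_simps inner_commute) (simp add: field_simps)

text \<open>First-order optimality condition without derivatives, the source of all variational
  equations below.\<close>

lemma nonneg_quadratic_linear_coeff_zero:
  fixes a b :: real
  assumes "\<And>t. 0 \<le> a * t\<^sup>2 + b * t" "a \<ge> 0"
  shows "b = 0"
proof (rule ccontr)
  assume "b \<noteq> 0"
  \<comment> \<open>The denominator \<open>a + 1\<close> also serves \<open>a = 0\<close>; the value
    at this point is strictly negative.\<close>
  have "0 \<le> a * (- b / (a + 1))\<^sup>2 + b * (- b / (a + 1))" by fact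
  also have "\<dots> = - b\<^sup>2 / (a + 1)\<^sup>2"
    using assms(2) by (simp add: divide_simps power2_eq_square) (simp add: algebra_simps)
  finally have "b\<^sup>2 / (a + 1)\<^sup>2 \<le> 0" by simp
  moreover have "b\<^sup>2 / (a + 1)\<^sup>2 > 0"
    using \<open>b \<noteq> 0\<close> \<open>a \<ge> 0\<close> by (intro divide_pos_pos) auto
  ultimately show False by simp
qed

text \<open>The representer is the minimiser of \<open>(norm x)^2 - 2 * \<phi> x\<close>, by the
  first variation of this functional.\<close>

lemma riesz_representer:
  fixes \<phi> :: "'a::{real_inner, complete_space} \<Rightarrow> real"
  assumes \<phi>: "bounded_linear \<phi>"
  obtains z where "\<And>x. \<phi> x = inner z x"
proof -
  interpret \<phi>: bounded_linear \<phi> by fact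
  define f where "f = (\<lambda>x. (norm x)\<^sup>2 - 2 * \<phi> x)"
  obtain B where B: "\<And>x. norm (\<phi> x) \<le> norm x * B" using \<phi>.bounded by blast
  \<comment> \<open>Completing the square in \<open>norm x\<close> bounds the functional from
    below.\<close>
  have "- B\<^sup>2 \<le> f x" for x
  proof -
    have "\<phi> x \<le> norm x * B" using B[of x] by simp
    then show ?thesis using zero_le_power2[of "norm x - B"]
      unfolding f_def power2_diff by simp
  qed
  then have "bdd_below (f ` UNIV)" by (intro bdd_belowI[of _ "- B\<^sup>2"]) auto
  moreover have "continuous_on UNIV f"
    unfolding f_def by (intro continuous_intros \<phi>.continuous_on)
  moreover have "f ((1/2) *\<^sub>R (x + y)) + 1/4 * (norm (x - y))\<^sup>2 \<le> (f x + f y) / 2" for x y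
    using parallelogram_midpoint[of x y]
    by (simp only: f_def \<phi>.scaleR \<phi>.add) (simp add: field_simps)
  ultimately obtain z where z: "\<And>y. f z \<le> f y"
    using midpoint_convex_attains_min[of UNIV f "1/4"] by auto
  have "2 * (inner z x - \<phi> x) = 0" for x
  proof (rule nonneg_quadratic_linear_coeff_zero)
    fix t :: real
    have "(norm (z + t *\<^sub>R x))\<^sup>2 = (norm z)\<^sup>2 + 2 * t * inner z x + t\<^sup>2 * (norm x)\<^sup>2"
      unfolding power2_norm_eq_inner by (simp add: inner_simps inner_commute power2_eq_square)
    then show "0 \<le> (norm x)\<^sup>2 * t\<^sup>2 + 2 * (inner z x - \<phi> x) * t"
      using z[of "z + t *\<^sub>R x"] unfolding f_def \<phi>.add \<phi>.scaleR by (simp add: algebra_simps)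
  qed simp
  then show ?thesis using that[of z] by simp
qed

text \<open>The point of the closed span nearest to \<open>x\<close> differs from \<open>x\<close>
  by a vector orthogonal to \<open>G\<close>, which the hypothesis forces to vanish.\<close>

lemma in_closure_span_if_trivial_complement:
  fixes G :: "'a::{real_inner, complete_space} set"
  assumes triv: "\<And>z. (\<And>g. g \<in> G \<Longrightarrow> inner z g = 0) \<Longrightarrow> z = 0"
  shows "x \<in> closure (span G)"
proof -
  let ?S = "closure (span G)"
  define f where "f = (\<lambda>y. (norm (y - x))\<^sup>2)"
  have conv: "convex ?S" by (simp add: subspace_imp_convex)
  have mid: "(1/2) *\<^sub>R (y + z) \<in> ?S" if "y \<in> ?S" "z \<in> ?S" for y z
    using convexD[OF conv that, of "1/2" "1/2"] by (simp add: scaleR_add_right)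
  have nonempty: "?S \<noteq> {}" using span_zero[of G] by (metis closure_eq_empty empty_iff)
  have bdd: "bdd_below (f ` ?S)" by (rule bdd_belowI[of _ 0]) (auto simp: f_def)
  have cont: "continuous_on ?S f" unfolding f_def by (intro continuous_intros)
  have "f ((1/2) *\<^sub>R (y + z)) + 1/4 * (norm (y - z))\<^sup>2 \<le> (f y + f z) / 2" for y z
  proof -
    have "(y - x) + (z - x) = (y + z) - (x + x)" by simp
    then have "(1/2) *\<^sub>R (y + z) - x = (1/2) *\<^sub>R ((y - x) + (z - x))"
      by (simp only: scaleR_diff_right scaleR_half_double)
    then show ?thesis using parallelogram_midpoint[of "y - x" "z - x"] by (simp add: f_def)
  qed
  then obtain p where p: "p \<in> ?S" "\<And>y. y \<in> ?S \<Longrightarrow> f p \<le> f y"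
    using midpoint_convex_attains_min[of ?S f "1/4"] mid nonempty bdd cont by (metis closed_closure zero_less_divide_1_iff zero_less_numeral)
  have "inner (p - x) g = 0" if g: "g \<in> G" for g
  proof -
    have "2 * inner (p - x) g = 0"
    proof (rule nonneg_quadratic_linear_coeff_zero)
      fix t :: real
      have "p + t *\<^sub>R g \<in> ?S"
        unfolding closure_approachable
      proof (intro allI impI)
        fix e :: real assume "0 < e"
        then obtain y where y: "y \<in> span G" "dist y p < e"
          using p(1) unfolding closure_approachable by blast
        have "y + t *\<^sub>R g \<in> span G" using y g by (simp add: span_add span_base span_scale)
        then show "\<exists>y\<in>span G. dist y (p + t *\<^sub>R g) < e" using y(2) by force
      qed
      then have "f p \<le> f (p + t *\<^sub>R g)" by (rule p(2))
      moreover have "f (p + t *\<^sub>R g) = f p + 2 * t * inner (p - x) g + t\<^sup>2 * (norm g)\<^sup>2"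
        unfolding f_def power2_norm_eq_inner
        by (simp add: inner_simps inner_commute power2_eq_square algebra_simps)
      ultimately show "0 \<le> (norm g)\<^sup>2 * t\<^sup>2 + 2 * inner (p - x) g * t"
        by (simp add: algebra_simps)
    qed simp
    then show ?thesis by simp
  qed
  then have "p - x = 0" by (rule triv)
  then show ?thesis using p(1) by simp
qed

section \<open>Strong convergence from finitely many functionals\<close>

text \<open>
  In \<open>\<parallel>z - x\<parallel>\<^sup>2 = \<parallel>z\<parallel>\<^sup>2 - \<parallel>x\<parallel>\<^sup>2 - 2 \<langle>x, z - x\<rangle>\<close>, the inner product is controlled after replacing \<open>x\<close> by a
  nearby finite combination of the representers of the functionals.
\<close>

lemma norm_close_if_functionals_close:
  fixes t :: "nat \<Rightarrow> 'a::{real_inner, complete_space} \<Rightarrow> real"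
  assumes t: "\<And>j. bounded_linear (t j)" and inj: "\<And>x. x \<noteq> 0 \<Longrightarrow> \<exists>j. t j x \<noteq> 0"
    and \<epsilon>: "\<epsilon> > 0"
  obtains N \<rho> where "\<rho> > 0"
    "\<And>m z. m \<ge> N \<Longrightarrow> (norm z)\<^sup>2 \<le> (norm x)\<^sup>2 + \<rho> \<Longrightarrow> L2_set (\<lambda>j. t j (z - x)) {..<m} \<le> \<rho> \<Longrightarrow>
       norm (z - x) < \<epsilon>"
proof -
  have "\<exists>g. \<forall>x. t j x = inner g x" for j
    using riesz_representer[OF t] by metis
  then obtain g where g: "\<And>j x. t j x = inner (g j) x" by metis
  \<comment> \<open>Since the functionals separate points, the span of their representers is
    dense.\<close>
  have "z = 0" if "\<And>h. h \<in> range g \<Longrightarrow> inner z h = 0" for z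
    using inj[of z] g that by (metis inner_commute rangeI)
  then have "x \<in> closure (span (range g))" by (rule in_closure_span_if_trivial_complement)
  then obtain w where w: "w \<in> span (range g)" "dist w x < \<epsilon> / 4"
    using \<epsilon> unfolding closure_approachable by (metis zero_less_divide_iff zero_less_numeral)
  \<comment> \<open>\<open>N\<close> exceeds every index occurring in \<open>w\<close>, so each
    functional involved is one coordinate of the truncated norm; \<open>C\<close> collects the
    absolute values of the coefficients.\<close>
  have "\<exists>N C. C \<ge> 0 \<and> (\<forall>m\<ge>N. \<forall>z. \<bar>inner w z\<bar> \<le> C * L2_set (\<lambda>j. t j z) {..<m})"
    using w(1)
  proof (induction rule: span_induct_alt)
    case base
    show ?case by (intro exI[of _ 0]) simp
  next
    case (step c h y)
    then obtain i where i: "h = g i" by auto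
    from step obtain N C where NC: "C \<ge> 0"
      "\<And>m z. m \<ge> N \<Longrightarrow> \<bar>inner y z\<bar> \<le> C * L2_set (\<lambda>j. t j z) {..<m}" by blast
    have "\<bar>inner (c *\<^sub>R h + y) z\<bar> \<le> (\<bar>c\<bar> + C) * L2_set (\<lambda>j. t j z) {..<m}"
      if "m \<ge> max N (Suc i)" for m z
    proof -
      have "\<bar>t i z\<bar> \<le> L2_set (\<lambda>j. \<bar>t j z\<bar>) {..<m}" using that by (intro member_le_L2_set) auto
      then have "\<bar>inner h z\<bar> \<le> L2_set (\<lambda>j. t j z) {..<m}" by (simp add: i g L2_set_def)
      then have "\<bar>c\<bar> * \<bar>inner h z\<bar> \<le> \<bar>c\<bar> * L2_set (\<lambda>j. t j z) {..<m}" by (simp add: mult_left_mono)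
      moreover have "\<bar>inner (c *\<^sub>R h + y) z\<bar> \<le> \<bar>c\<bar> * \<bar>inner h z\<bar> + \<bar>inner y z\<bar>"
        by (simp add: inner_simps abs_mult[symmetric])
      ultimately show ?thesis using NC(2)[of m z] that by (simp add: distrib_right)
    qed
    then show ?case using NC(1) by (intro exI[of _ "max N (Suc i)"] exI[of _ "\<bar>c\<bar> + C"]) auto
  qed
  then obtain N C where C: "C \<ge> 0"
    and NC: "\<And>m z. m \<ge> N \<Longrightarrow> \<bar>inner w z\<bar> \<le> C * L2_set (\<lambda>j. t j z) {..<m}" by blast
  \<comment> \<open>This makes \<open>\<rho> + 2 * C * \<rho>\<close> equal to
    \<open>\<epsilon>^2 / 4\<close>. With \<open>w\<close> within \<open>\<epsilon> / 4\<close> of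
    \<open>x\<close>, the distance \<open>s\<close> then satisfies
    \<open>s^2 \<le> \<epsilon>^2 / 4 + \<epsilon> / 2 * s\<close>, which excludes
    \<open>s \<ge> \<epsilon>\<close>.\<close>
  define \<rho> where "\<rho> = \<epsilon>\<^sup>2 / (4 * (1 + 2 * C))"
  have \<rho>: "\<rho> > 0" "\<rho> * (1 + 2 * C) = \<epsilon>\<^sup>2 / 4"
    using \<epsilon> C by (auto simp: \<rho>_def divide_simps)
  show ?thesis
  proof (rule that[of \<rho> N])
    fix m z assume m: "m \<ge> N" and z: "(norm z)\<^sup>2 \<le> (norm x)\<^sup>2 + \<rho>"
      and L: "L2_set (\<lambda>j. t j (z - x)) {..<m} \<le> \<rho>"
    define s where "s = norm (z - x)"
    have "s\<^sup>2 = (norm z)\<^sup>2 - (norm x)\<^sup>2 - 2 * inner w (z - x) + 2 * inner (w - x) (z - x)"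
      unfolding s_def power2_norm_eq_inner by (simp add: inner_simps inner_commute)
    moreover have "\<bar>inner w (z - x)\<bar> \<le> C * \<rho>"
      using NC[OF m, of "z - x"] mult_left_mono[OF L C] by linarith
    moreover have "inner (w - x) (z - x) \<le> \<epsilon> / 4 * s"
    proof -
      have "norm (w - x) * s \<le> \<epsilon> / 4 * s"
        using w(2) by (intro mult_right_mono) (auto simp: dist_norm s_def)
      then show ?thesis using norm_cauchy_schwarz[of "w - x" "z - x"] by (simp add: s_def)
    qed
    ultimately have s: "s\<^sup>2 \<le> \<epsilon>\<^sup>2 / 4 + \<epsilon> / 2 * s"
      using z \<rho>(2) by (simp add: algebra_simps)
    show "norm (z - x) < \<epsilon>"
    proof (rule ccontr)
      assume "\<not> norm (z - x) < \<epsilon>"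
      then have "\<epsilon> \<le> s" by (simp add: s_def)
      then have "\<epsilon>\<^sup>2 \<le> s\<^sup>2" "\<epsilon> * s \<le> s\<^sup>2" "0 < s\<^sup>2"
        using \<epsilon> by (auto simp: power2_eq_square intro: mult_mono mult_right_mono)
      then show False using s by linarith
    qed
  qed (use \<rho> in auto)
qed

section \<open>Tikhonov regularisation with finitely many channels\<close>

lemma residual_power2: "(residual l K m v x)\<^sup>2 = (\<Sum>j<m. (l j (K x) - v j)\<^sup>2)"
  by (simp add: residual_def L2_set_def channel_op_def sum_nonneg)

lemma residual_nonneg [simp]: "0 \<le> residual l K m v x"
  by (simp add: residual_def)

text \<open>Only the composed functionals \<open>\<lambda>x. l j (K x)\<close> are visible here, so
  \<open>'b\<close> can be a bare type.\<close>

locale tikhonov_problem =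
  fixes l :: "nat \<Rightarrow> 'b \<Rightarrow> real" and K :: "'a::{real_inner, complete_space} \<Rightarrow> 'b"
  assumes bounded_linear_channel: "\<And>j. bounded_linear (\<lambda>x. l j (K x))"
begin

lemma channel_linear:
  shows channel_add: "l j (K (x + y)) = l j (K x) + l j (K y)"
    and channel_diff: "l j (K (x - y)) = l j (K x) - l j (K y)"
    and channel_scaleR: "l j (K (c *\<^sub>R x)) = c * l j (K x)"
  using linear_add[OF bounded_linear.linear[OF bounded_linear_channel[of j]], of x y]
    linear_diff[OF bounded_linear.linear[OF bounded_linear_channel[of j]], of x y]
    linear_scale[OF bounded_linear.linear[OF bounded_linear_channel[of j]], of c x]
  by auto

abbreviation "minimiser \<equiv> tikhonov_minimiser l K"

lemma continuous_residual: "continuous_on S (residual l K m v)"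
proof -
  have "residual l K m v = (\<lambda>x. sqrt (\<Sum>j<m. (l j (K x) - v j)\<^sup>2))"
    by (rule ext) (simp add: residual_def L2_set_def channel_op_def)
  then show ?thesis
    by (auto intro!: continuous_intros bounded_linear.continuous_on[OF bounded_linear_channel])
qed

text \<open>Converts small residuals at two points into the closeness of functionals that
  \<open>norm_close_if_functionals_close\<close> asks for.\<close>

lemma L2_set_channel_diff_le:
  "L2_set (\<lambda>j. l j (K (z - x))) {..<m} \<le> residual l K m v z + residual l K m v x"
proof -
  have "L2_set (\<lambda>j. l j (K (z - x))) {..<m}
      = L2_set (\<lambda>j. (l j (K z) - v j) + - (l j (K x) - v j)) {..<m}"
    by (simp add: channel_diff)
  also have "\<dots> \<le> L2_set (\<lambda>j. l j (K z) - v j) {..<m} + L2_set (\<lambda>j. - (l j (K x) - v j)) {..<m}"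
    by (rule L2_set_triangle_ineq)
  also have "\<dots> = residual l K m v z + residual l K m v x"
    by (simp only: residual_def L2_set_def channel_op_def power2_minus) simp
  finally show ?thesis .
qed

text \<open>The data term is merely convex; the modulus \<open>\<alpha> / 4\<close> comes from the
  penalty through the parallelogram law.\<close>

lemma tikhonov_functional_midpoint:
  fixes v m \<alpha>
  defines "J \<equiv> \<lambda>x. (residual l K m v x)\<^sup>2 + \<alpha> * (norm x)\<^sup>2"
  shows "J ((1/2) *\<^sub>R (x + y)) + \<alpha> / 4 * (norm (x - y))\<^sup>2 \<le> (J x + J y) / 2"
proof -
  have "(1/2 * (a + b) - c)\<^sup>2 \<le> ((a - c)\<^sup>2 + (b - c)\<^sup>2) / 2" for a b c :: real
  proof -
    have "((a - c)\<^sup>2 + (b - c)\<^sup>2) / 2 - (1/2 * (a + b) - c)\<^sup>2 = (a - b)\<^sup>2 / 4"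
      by (simp add: power2_eq_square field_simps)
    then show ?thesis by (smt (verit) divide_nonneg_pos zero_le_power2)
  qed
  then have "(residual l K m v ((1/2) *\<^sub>R (x + y)))\<^sup>2
      \<le> (\<Sum>j<m. ((l j (K x) - v j)\<^sup>2 + (l j (K y) - v j)\<^sup>2) / 2)"
    unfolding residual_power2 channel_scaleR channel_add by (intro sum_mono) auto
  also have "\<dots> = ((residual l K m v x)\<^sup>2 + (residual l K m v y)\<^sup>2) / 2"
    by (simp add: residual_power2 sum.distrib flip: sum_divide_distrib)
  finally have "(residual l K m v ((1/2) *\<^sub>R (x + y)))\<^sup>2
    \<le> ((residual l K m v x)\<^sup>2 + (residual l K m v y)\<^sup>2) / 2" .
  moreover have "\<alpha> * (norm ((1/2) *\<^sub>R (x + y)))\<^sup>2 + \<alpha> / 4 * (norm (x - y))\<^sup>2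
      = (\<alpha> * (norm x)\<^sup>2 + \<alpha> * (norm y)\<^sup>2) / 2"
    using arg_cong[OF parallelogram_midpoint[of x y], of "\<lambda>r. \<alpha> * r"] by (simp add: field_simps)
  ultimately show ?thesis unfolding J_def by argo
qed

text \<open>Existence and uniqueness both follow from the midpoint inequality, which justifies the
  definite description in \<open>tikhonov_minimiser\<close>.\<close>

lemma minimiser_is_arg_min:
  assumes \<alpha>: "\<alpha> > 0"
  shows "is_arg_min (\<lambda>x. (residual l K m v x)\<^sup>2 + \<alpha> * (norm x)\<^sup>2) (\<lambda>_. True) (minimiser m \<alpha> v)"
proof -
  define J where "J = (\<lambda>x. (residual l K m v x)\<^sup>2 + \<alpha> * (norm x)\<^sup>2)"
  have mid: "J ((1/2) *\<^sub>R (x + y)) + \<alpha> / 4 * (norm (x - y))\<^sup>2 \<le> (J x + J y) / 2" for x y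
    unfolding J_def by (rule tikhonov_functional_midpoint)
  have cont: "continuous_on UNIV J"
    unfolding J_def by (intro continuous_intros continuous_residual)
  have bdd: "bdd_below (J ` UNIV)"
    using \<alpha> by (intro bdd_belowI[of _ 0]) (auto simp: J_def)
  obtain z where z: "\<And>y. J z \<le> J y"
  proof (rule midpoint_convex_attains_min[OF _ _ cont bdd _ _ mid])
    show "\<alpha> / 4 > 0" using \<alpha> by simp
  qed auto
  have "y = z" if "is_arg_min J (\<lambda>_. True) y" for y
  proof -
    have "J y \<le> J z" using that by (auto simp: is_arg_min_linorder)
    then have "\<alpha> / 4 * (norm (y - z))\<^sup>2 \<le> 0"
      using mid[of y z] z[of "(1/2) *\<^sub>R (y + z)"] by argo
    then show ?thesis using \<alpha> by (simp add: mult_le_0_iff)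
  qed
  moreover have "is_arg_min J (\<lambda>_. True) z" using z by (simp add: is_arg_min_linorder)
  ultimately have "\<exists>!z. is_arg_min J (\<lambda>_. True) z" by blast
  then show ?thesis unfolding tikhonov_minimiser_def J_def[symmetric] by (rule theI')
qed

lemma minimiser_le:
  assumes "\<alpha> > 0"
  shows "(residual l K m v (minimiser m \<alpha> v))\<^sup>2 + \<alpha> * (norm (minimiser m \<alpha> v))\<^sup>2
    \<le> (residual l K m v x)\<^sup>2 + \<alpha> * (norm x)\<^sup>2"
  using minimiser_is_arg_min[OF assms, of m v] by (auto simp: is_arg_min_linorder)

lemma norm_minimiser_le:
  assumes "\<alpha> > 0"
  shows "(norm (minimiser m \<alpha> v))\<^sup>2 \<le> (norm x)\<^sup>2 + (residual l K m v x)\<^sup>2 / \<alpha>"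
proof -
  have "\<alpha> * (norm (minimiser m \<alpha> v))\<^sup>2 \<le> (residual l K m v x)\<^sup>2 + \<alpha> * (norm x)\<^sup>2"
    using minimiser_le[OF assms, of m v x] by (smt (verit) zero_le_power2)
  then show ?thesis using assms by (simp add: field_simps)
qed

lemma residual_minimiser_le:
  assumes "\<alpha> > 0"
  shows "(residual l K m v (minimiser m \<alpha> v))\<^sup>2 \<le> (residual l K m v x)\<^sup>2 + \<alpha> * (norm x)\<^sup>2"
  using minimiser_le[OF assms, of m v x] assms by (smt (verit) mult_nonneg_nonneg zero_le_power2)

section \<open>Normal equation and dependence on the regularisation parameter\<close>

lemma normal_equation:
  assumes \<alpha>: "\<alpha> > 0"
  shows "(\<Sum>j<m. (l j (K (minimiser m \<alpha> v)) - v j) * l j (K h)) = - \<alpha> * inner (minimiser m \<alpha> v) h"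
proof -
  let ?x = "minimiser m \<alpha> v"
  let ?r = "\<lambda>j. l j (K ?x) - v j"
  have "2 * ((\<Sum>j<m. ?r j * l j (K h)) + \<alpha> * inner ?x h) = 0"
  proof (rule nonneg_quadratic_linear_coeff_zero)
    fix t :: real
    have "(residual l K m v (?x + t *\<^sub>R h))\<^sup>2 = (\<Sum>j<m. (?r j + t * l j (K h))\<^sup>2)"
      unfolding residual_power2 channel_add channel_scaleR by (simp add: algebra_simps)
    also have "\<dots> = (residual l K m v ?x)\<^sup>2 + 2 * t * (\<Sum>j<m. ?r j * l j (K h))
        + t\<^sup>2 * (\<Sum>j<m. (l j (K h))\<^sup>2)"
      unfolding residual_power2 sum_distrib_left sum.distrib[symmetric]
      by (intro sum.cong) (auto simp: power2_eq_square algebra_simps)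
    moreover have "(norm (?x + t *\<^sub>R h))\<^sup>2 = (norm ?x)\<^sup>2 + 2 * t * inner ?x h + t\<^sup>2 * (norm h)\<^sup>2"
      unfolding power2_norm_eq_inner by (simp add: inner_simps inner_commute power2_eq_square)
    ultimately show "0 \<le> ((\<Sum>j<m. (l j (K h))\<^sup>2) + \<alpha> * (norm h)\<^sup>2) * t\<^sup>2
        + 2 * ((\<Sum>j<m. ?r j * l j (K h)) + \<alpha> * inner ?x h) * t"
      using minimiser_le[OF \<alpha>, of m v "?x + t *\<^sub>R h"] by (simp add: algebra_simps)
  qed (use \<alpha> in \<open>simp add: sum_nonneg\<close>)
  then show ?thesis by simp
qed

text \<open>
  In spectral terms the scaled residual \<open>u = (v - T x) / \<alpha>\<close> is \<open>(\<alpha> + T T\<^sup>*)\<^sup>-\<^sup>1 v\<close>, whose norm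
  decreases in \<open>\<alpha>\<close>; the normal equation gives this without spectral calculus.
\<close>

lemma residual_minimiser_ratio:
  assumes a: "0 < a" "a < b"
  shows "residual l K m v (minimiser m b v) \<le> b / a * residual l K m v (minimiser m a v)"
proof -
  let ?x = "minimiser m a v" and ?y = "minimiser m b v"
  have b: "b > 0" using a by simp
  define u where "u = (\<lambda>j. (v j - l j (K ?x)) / a)"
  define w where "w = (\<lambda>j. (v j - l j (K ?y)) / b)"
  have u: "(\<Sum>j<m. u j * l j (K h)) = inner ?x h" for h
  proof -
    have "(\<Sum>j<m. u j * l j (K h)) = - (1/a) * (\<Sum>j<m. (l j (K ?x) - v j) * l j (K h))"
      unfolding u_def sum_distrib_left using a(1) by (intro sum.cong) (auto simp: field_simps)
    then show ?thesis unfolding normal_equation[OF a(1)] using a(1) by simp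
  qed
  have w: "(\<Sum>j<m. w j * l j (K h)) = inner ?y h" for h
  proof -
    have "(\<Sum>j<m. w j * l j (K h)) = - (1/b) * (\<Sum>j<m. (l j (K ?y) - v j) * l j (K h))"
      unfolding w_def sum_distrib_left using b by (intro sum.cong) (auto simp: field_simps)
    then show ?thesis unfolding normal_equation[OF b] using b by simp
  qed
  have d: "l j (K (?x - ?y)) = - a * (u j - w j) + (b - a) * w j" for j
    unfolding channel_diff u_def w_def using a b by (simp add: field_simps)
  \<comment> \<open>This pairing is a squared norm by the normal equations. Expanding it through
    \<open>d\<close> as well shows that \<open>u - w\<close> has nonnegative inner product with
    \<open>w\<close>, so \<open>u\<close> is at least as long as \<open>w\<close>.\<close>
  have "(\<Sum>j<m. (u j - w j) * l j (K (?x - ?y))) = inner (?x - ?y) (?x - ?y)"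
    unfolding left_diff_distrib sum_subtractf u w by (simp add: inner_diff_left)
  moreover have "(\<Sum>j<m. (u j - w j) * l j (K (?x - ?y)))
      = - a * (\<Sum>j<m. (u j - w j)\<^sup>2) + (b - a) * (\<Sum>j<m. (u j - w j) * w j)"
    unfolding d sum_distrib_left sum.distrib[symmetric]
    by (intro sum.cong) (auto simp: power2_eq_square algebra_simps)
  moreover have "0 \<le> a * (\<Sum>j<m. (u j - w j)\<^sup>2)" using a by (simp add: sum_nonneg)
  ultimately have "0 \<le> (b - a) * (\<Sum>j<m. (u j - w j) * w j)"
    using inner_ge_zero[of "?x - ?y"] by linarith
  then have "0 \<le> (\<Sum>j<m. (u j - w j) * w j)" using a by (simp add: zero_le_mult_iff)
  moreover have "(\<Sum>j<m. (u j)\<^sup>2) = (\<Sum>j<m. (w j)\<^sup>2) + 2 * (\<Sum>j<m. (u j - w j) * w j)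
      + (\<Sum>j<m. (u j - w j)\<^sup>2)"
    unfolding sum_distrib_left sum.distrib[symmetric]
    by (intro sum.cong) (auto simp: power2_eq_square algebra_simps)
  ultimately have "(\<Sum>j<m. (w j)\<^sup>2) \<le> (\<Sum>j<m. (u j)\<^sup>2)"
    by (smt (verit) sum_nonneg zero_le_power2)
  moreover have "(\<Sum>j<m. (w j)\<^sup>2) = (residual l K m v ?y / b)\<^sup>2"
    unfolding w_def power_divide residual_power2 sum_divide_distrib by (simp add: power2_commute)
  moreover have "(\<Sum>j<m. (u j)\<^sup>2) = (residual l K m v ?x / a)\<^sup>2"
    unfolding u_def power_divide residual_power2 sum_divide_distrib by (simp add: power2_commute)
  ultimately have "(residual l K m v ?y / b)\<^sup>2 \<le> (residual l K m v ?x / a)\<^sup>2" by simp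
  then have "residual l K m v ?y / b \<le> residual l K m v ?x / a"
    by (rule power2_le_imp_le) (use a in simp)
  then show ?thesis using a b by (simp add: field_simps)
qed

text \<open>Subtracting the two normal equations in the direction of the difference shows that this
  direction makes no obtuse angle with the minimiser for \<open>b\<close>. Boundedness of the norms
  then suffices for a Cauchy property as the parameter decreases.\<close>

lemma minimiser_diff_le:
  assumes a: "0 < a" "a < b"
  shows "(norm (minimiser m a v - minimiser m b v))\<^sup>2
    \<le> (norm (minimiser m a v))\<^sup>2 - (norm (minimiser m b v))\<^sup>2"
proof -
  let ?x = "minimiser m a v" and ?y = "minimiser m b v"
  have b: "b > 0" using a by simp
  have "(\<Sum>j<m. (l j (K (?x - ?y)))\<^sup>2) =
    (\<Sum>j<m. (l j (K ?x) - v j) * l j (K (?x - ?y))) - (\<Sum>j<m. (l j (K ?y) - v j) * l j (K (?x - ?y)))"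
    unfolding sum_subtractf[symmetric] channel_diff
    by (intro sum.cong) (auto simp: power2_eq_square algebra_simps)
  also have "\<dots> = (b - a) * inner ?y (?x - ?y) - a * (norm (?x - ?y))\<^sup>2"
    unfolding normal_equation[OF a(1)] normal_equation[OF b] power2_norm_eq_inner
    by (simp add: inner_simps algebra_simps)
  finally have "0 \<le> (b - a) * inner ?y (?x - ?y) - a * (norm (?x - ?y))\<^sup>2"
    by (metis sum_nonneg zero_le_power2)
  moreover have "0 \<le> a * (norm (?x - ?y))\<^sup>2" using a by simp
  ultimately have "0 \<le> (b - a) * inner ?y (?x - ?y)" by linarith
  then have "0 \<le> inner ?y (?x - ?y)" using a by (simp add: zero_le_mult_iff)
  moreover have "(norm (?x - ?y))\<^sup>2 = (norm ?x)\<^sup>2 - (norm ?y)\<^sup>2 - 2 * inner ?y (?x - ?y)"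
    unfolding power2_norm_eq_inner by (simp add: inner_simps inner_commute)
  ultimately show ?thesis by linarith
qed

text \<open>Covers the value of \<open>tikhonov\<close> at parameter \<open>0\<close>: for exact
  data the norms stay below \<open>norm x\<close> and grow as the parameter decreases, so the
  minimisers are Cauchy.\<close>

lemma minimiser_converges_exact_data:
  assumes x: "residual l K m v x = 0"
  obtains z where "((\<lambda>a. minimiser m a v) \<longlongrightarrow> z) (at_right 0)"
    "norm z \<le> norm x" "residual l K m v z = 0"
proof -
  let ?f = "\<lambda>a. minimiser m a v"
  have norm_le: "norm (?f a) \<le> norm x" if "a > 0" for a
    using norm_minimiser_le[OF that, of m v x] x by (intro power2_le_imp_le[of "norm (?f a)"]) auto
  define L where "L = (SUP a\<in>{0<..}. (norm (?f a))\<^sup>2)"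
  have bdd: "bdd_above ((\<lambda>a. (norm (?f a))\<^sup>2) ` {0<..})"
    using norm_le by (intro bdd_aboveI[of _ "(norm x)\<^sup>2"]) (auto intro: power_mono)
  have L: "(norm (?f a))\<^sup>2 \<le> L" if "a > 0" for a
    unfolding L_def using that bdd by (intro cSUP_upper) auto
  have "cauchy_filter (filtermap ?f (at_right 0))"
    unfolding cauchy_filter_metric_filtermap
  proof (intro allI impI)
    fix e :: real assume e: "e > 0"
    then have "L - e\<^sup>2 < L" by simp
    \<comment> \<open>Below \<open>c\<close> the squared norms lie within \<open>e^2\<close> of
      their supremum, so they can differ by less than \<open>e^2\<close> only.\<close>
    then obtain c where c: "c > 0" "L - e\<^sup>2 < (norm (?f c))\<^sup>2"
      unfolding L_def using less_cSUP_iff[OF _ bdd] by force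
    have *: "dist (?f a) (?f b) < e" if "0 < a" "a < b" "b < c" for a b
    proof -
      have "(norm (?f c))\<^sup>2 \<le> (norm (?f b))\<^sup>2"
        using minimiser_diff_le[of b c m v] that by (smt (verit) zero_le_power2)
      then have "(norm (?f a - ?f b))\<^sup>2 < e\<^sup>2"
        using minimiser_diff_le[of a b m v] that L[of a] c(2) by linarith
      then show ?thesis using e by (simp add: dist_norm power_less_imp_less_base)
    qed
    have "dist (?f a) (?f b) < e" if "0 < a" "a < c" "0 < b" "b < c" for a b
      using *[of a b] *[of b a] that e by (cases a b rule: linorder_cases) (auto simp: dist_commute)
    moreover have "eventually (\<lambda>a. 0 < a \<and> a < c) (at_right 0)"
      using c(1) by (auto simp: eventually_at_right)
    ultimately show "\<exists>P. eventually P (at_right 0) \<and> (\<forall>a b. P a \<and> P b \<longrightarrow> dist (?f a) (?f b) < e)"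
      by (intro exI[of _ "\<lambda>a. 0 < a \<and> a < c"]) auto
  qed
  then obtain z where "filtermap ?f (at_right 0) \<le> nhds z"
    using complete_uniform[of "UNIV :: 'a set"] complete_UNIV
    by (force simp: filtermap_bot_iff trivial_limit_at_right_real)
  then have z: "(?f \<longlongrightarrow> z) (at_right 0)" by (simp add: filterlim_def)
  have ev: "eventually (\<lambda>a::real. a > 0) (at_right 0)" by (simp add: eventually_at_right_less)
  have "norm z \<le> norm x"
    by (rule tendsto_upperbound[OF tendsto_norm[OF z]]) (use ev norm_le in \<open>auto elim: eventually_mono\<close>)
  moreover have "(residual l K m v z)\<^sup>2 \<le> 0 * (norm x)\<^sup>2"
  proof (rule tendsto_le[of "at_right 0"])
    show "((\<lambda>a. (residual l K m v (?f a))\<^sup>2) \<longlongrightarrow> (residual l K m v z)\<^sup>2) (at_right 0)"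
      by (intro tendsto_power continuous_on_tendsto_compose[OF continuous_residual[of UNIV] z]) auto
    show "((\<lambda>a. a * (norm x)\<^sup>2) \<longlongrightarrow> 0 * (norm x)\<^sup>2) (at_right 0)"
      by (intro tendsto_intros)
    show "eventually (\<lambda>a. (residual l K m v (?f a))\<^sup>2 \<le> a * (norm x)\<^sup>2) (at_right 0)"
      using ev by eventually_elim (use residual_minimiser_le[of _ m v x] x in simp)
  qed simp
  ultimately show ?thesis using that z by simp
qed

section \<open>Deterministic convergence of the discrepancy principle\<close>

text \<open>\<open>N\<close> and \<open>\<eta>\<close> are chosen before \<open>d\<close> and
  \<open>v\<close>, so the bound can be applied separately to each outcome of the
  experiment.\<close>

theorem discrepancy_principle_converges:
  assumes inj: "\<And>x. x \<noteq> 0 \<Longrightarrow> \<exists>j. l j (K x) \<noteq> 0"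
    and \<tau>: "0 < \<tau>0" "\<tau>0 < \<tau>" and q: "0 < q" "q < 1" and \<epsilon>: "\<epsilon> > 0"
  obtains N \<eta> where "\<eta> > 0"
    "\<And>m d v. m \<ge> N \<Longrightarrow> 0 \<le> d \<Longrightarrow> d \<le> \<eta> \<Longrightarrow> residual l K m v x \<le> \<tau>0 * d \<Longrightarrow>
       norm (tikhonov l K m (discrepancy_alpha l K m \<tau> q d v) v - x) < \<epsilon>"
proof -
  have \<tau>2: "\<tau>0\<^sup>2 < \<tau>\<^sup>2" using \<tau> by (simp add: power_strict_mono)
  obtain N1 \<rho>1 where \<rho>1: "\<rho>1 > 0" and N1:
    "\<And>m z. m \<ge> N1 \<Longrightarrow> (norm z)\<^sup>2 \<le> (norm x)\<^sup>2 + \<rho>1 \<Longrightarrow> L2_set (\<lambda>j. l j (K (z - x))) {..<m} \<le> \<rho>1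
      \<Longrightarrow> norm (z - x) < \<epsilon>"
    using norm_close_if_functionals_close[OF bounded_linear_channel inj \<epsilon>, of x] by metis
  \<comment> \<open>The accuracy demanded of the minimiser at the previous parameter, solved from
    the final requirement \<open>\<tau>0^2 * d^2 / q ^ k \<le> \<rho>1\<close>. The summand
    \<open>1\<close> admits \<open>x = 0\<close>.\<close>
  define \<epsilon>2 where "\<epsilon>2 = \<rho>1 * q * (\<tau>\<^sup>2 - \<tau>0\<^sup>2) / (2 * \<tau>0\<^sup>2 * (norm x + 1))"
  have \<epsilon>2: "\<epsilon>2 > 0"
    unfolding \<epsilon>2_def using \<rho>1 q \<tau> \<tau>2 by (intro divide_pos_pos mult_pos_pos) (auto simp: add_nonneg_pos)
  have \<epsilon>2_eq: "\<tau>0\<^sup>2 * (2 * (norm x + 1) * \<epsilon>2) = \<rho>1 * q * (\<tau>\<^sup>2 - \<tau>0\<^sup>2)"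
  proof -
    have "2 * \<tau>0\<^sup>2 * (norm x + 1) \<noteq> 0" using \<tau>(1) norm_ge_zero[of x] by (smt (verit) mult_pos_pos zero_less_power)
    then show ?thesis unfolding \<epsilon>2_def by (simp add: field_simps)
  qed
  obtain N2 \<rho>2 where \<rho>2: "\<rho>2 > 0" and N2:
    "\<And>m z. m \<ge> N2 \<Longrightarrow> (norm z)\<^sup>2 \<le> (norm x)\<^sup>2 + \<rho>2 \<Longrightarrow> L2_set (\<lambda>j. l j (K (z - x))) {..<m} \<le> \<rho>2
      \<Longrightarrow> norm (z - x) < \<epsilon>2"
    using norm_close_if_functionals_close[OF bounded_linear_channel inj \<epsilon>2, of x] by metis
  \<comment> \<open>The three entries control, in order, the functionals at the selected minimiser,
    those at the previous minimiser, and a stop at \<open>k = 0\<close>.\<close>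
  define \<eta> where "\<eta> = Min {\<rho>1 / (\<tau> + \<tau>0), \<rho>2 / (\<tau> / q + \<tau>0), sqrt \<rho>1 / \<tau>0}"
  have pos: "\<tau> + \<tau>0 > 0" "\<tau> / q + \<tau>0 > 0" using \<tau> q by (auto intro: add_pos_pos divide_pos_pos)
  have \<eta>: "\<eta> > 0" unfolding \<eta>_def using \<rho>1 \<rho>2 \<tau> pos by simp
  have \<eta>_le: "(\<tau> + \<tau>0) * d \<le> \<rho>1" "(\<tau> / q + \<tau>0) * d \<le> \<rho>2" "\<tau>0\<^sup>2 * d\<^sup>2 \<le> \<rho>1" if "0 \<le> d" "d \<le> \<eta>" for d
  proof -
    have d: "d \<le> \<rho>1 / (\<tau> + \<tau>0)" "d \<le> \<rho>2 / (\<tau> / q + \<tau>0)" "d \<le> sqrt \<rho>1 / \<tau>0"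
      using that unfolding \<eta>_def by auto
    show "(\<tau> + \<tau>0) * d \<le> \<rho>1" "(\<tau> / q + \<tau>0) * d \<le> \<rho>2"
      using d(1,2) pos by (simp_all only: pos_le_divide_eq mult.commute)
    have "\<tau>0 * d \<le> sqrt \<rho>1" using d(3) \<tau>(1) by (simp add: pos_le_divide_eq mult.commute)
    then have "(\<tau>0 * d)\<^sup>2 \<le> (sqrt \<rho>1)\<^sup>2" using that \<tau> by (intro power_mono) auto
    then show "\<tau>0\<^sup>2 * d\<^sup>2 \<le> \<rho>1" using \<rho>1 by (simp add: power_mult_distrib)
  qed
  show ?thesis
  proof (rule that[of \<eta> "max N1 N2"])
    fix m d v assume m: "max N1 N2 \<le> m" and d: "0 \<le> d" "d \<le> \<eta>" and e: "residual l K m v x \<le> \<tau>0 * d"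
    have e2: "(residual l K m v x)\<^sup>2 \<le> \<tau>0\<^sup>2 * d\<^sup>2"
      using power_mono[OF e, of 2] by (simp add: power_mult_distrib)
    let ?stop = "discrepancy_stop l K m \<tau> q d v"
    show "norm (tikhonov l K m (discrepancy_alpha l K m \<tau> q d v) v - x) < \<epsilon>"
    proof (cases "\<exists>k. ?stop k")
      case True
      define k where "k = (LEAST k. ?stop k)"
      define z where "z = minimiser m (q ^ k) v"
      have qk: "q ^ k > 0" using q by simp
      have "?stop k" unfolding k_def using True by (rule LeastI_ex)
      then have res: "residual l K m v z \<le> \<tau> * d"
        using qk by (simp add: discrepancy_stop_def tikhonov_def z_def)
      have "\<tau>0\<^sup>2 * d\<^sup>2 / q ^ k \<le> \<rho>1"
      proof (cases k)
        \<comment> \<open>There is no previous parameter; the selected one is \<open>1\<close>, and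
          smallness of \<open>d\<close> suffices.\<close>
        case 0
        then show ?thesis using \<eta>_le(3)[OF d] by simp
      next
        case (Suc i)
        define a y where "a = q ^ i" and "y = minimiser m a v"
        have a: "a > 0" "q ^ k = q * a" "q ^ k < a" using q by (auto simp: a_def Suc)
        have "\<not> ?stop i" using not_less_Least[of i ?stop] Suc k_def by simp
        then have y: "residual l K m v y > \<tau> * d"
          using a(1) by (simp add: discrepancy_stop_def tikhonov_def y_def a_def)
        have "(\<tau> * d)\<^sup>2 \<le> (residual l K m v y)\<^sup>2"
          using y \<tau> d by (intro power_mono) auto
        then have gap: "\<tau>\<^sup>2 * d\<^sup>2 + a * (norm y)\<^sup>2 \<le> \<tau>0\<^sup>2 * d\<^sup>2 + a * (norm x)\<^sup>2"
          using minimiser_le[OF a(1), of m v x] e2 unfolding y_def by (simp add: power_mult_distrib)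
        then have "a * (norm y)\<^sup>2 \<le> a * (norm x)\<^sup>2"
          using \<tau>2 by (smt (verit) mult_right_mono zero_le_power2)
        then have ny: "(norm y)\<^sup>2 \<le> (norm x)\<^sup>2" using a(1) by simp
        \<comment> \<open>Not stopping at \<open>y\<close> bounds its residual from below only; the
          upper bound is inherited from \<open>z\<close>, whose parameter is just a factor
          \<open>q\<close> smaller.\<close>
        have "residual l K m v y \<le> a / q ^ k * residual l K m v z"
          unfolding y_def z_def using qk a(3) by (rule residual_minimiser_ratio)
        also have "\<dots> \<le> a / q ^ k * (\<tau> * d)"
          using res qk a(1) by (intro mult_left_mono) auto
        also have "\<dots> = \<tau> / q * d" using a by simp
        finally have "L2_set (\<lambda>j. l j (K (y - x))) {..<m} \<le> \<rho>2"
          using L2_set_channel_diff_le[of y x m v] e \<eta>_le(2)[OF d] by (simp add: distrib_right)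
        then have "norm (y - x) < \<epsilon>2" using N2[of m y] m ny \<rho>2 by simp
        then have diff: "norm x - norm y \<le> \<epsilon>2" using norm_triangle_ineq2[of x y] by (simp add: norm_minus_commute)
        have "norm y \<le> norm x" using ny by (rule power2_le_imp_le) simp
        then have "(norm x - norm y) * (norm x + norm y) \<le> \<epsilon>2 * (2 * (norm x + 1))"
          using diff \<epsilon>2 by (intro mult_mono) auto
        then have "(norm x)\<^sup>2 - (norm y)\<^sup>2 \<le> 2 * (norm x + 1) * \<epsilon>2"
          by (simp add: power2_eq_square algebra_simps)
        then have "a * ((norm x)\<^sup>2 - (norm y)\<^sup>2) \<le> a * (2 * (norm x + 1) * \<epsilon>2)"
          using a(1) by (simp only: mult_le_cancel_left_pos)
        then have "(\<tau>\<^sup>2 - \<tau>0\<^sup>2) * d\<^sup>2 \<le> a * (2 * (norm x + 1) * \<epsilon>2)"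
          using gap by (simp add: algebra_simps)
        then have "\<tau>0\<^sup>2 * ((\<tau>\<^sup>2 - \<tau>0\<^sup>2) * d\<^sup>2) \<le> \<tau>0\<^sup>2 * (a * (2 * (norm x + 1) * \<epsilon>2))"
          by (rule mult_left_mono) simp
        also have "\<dots> = a * (\<tau>0\<^sup>2 * (2 * (norm x + 1) * \<epsilon>2))" by (simp only: mult_ac)
        also have "\<dots> = (\<tau>\<^sup>2 - \<tau>0\<^sup>2) * (\<rho>1 * q ^ k)" unfolding \<epsilon>2_eq a(2) by (simp only: mult_ac)
        finally have "(\<tau>\<^sup>2 - \<tau>0\<^sup>2) * (\<tau>0\<^sup>2 * d\<^sup>2) \<le> (\<tau>\<^sup>2 - \<tau>0\<^sup>2) * (\<rho>1 * q ^ k)" by (simp only: mult_ac)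
        then have "\<tau>0\<^sup>2 * d\<^sup>2 \<le> \<rho>1 * q ^ k" using \<tau>2 by simp
        then show ?thesis using qk by (simp add: pos_divide_le_eq)
      qed
      moreover have "(residual l K m v x)\<^sup>2 / q ^ k \<le> \<tau>0\<^sup>2 * d\<^sup>2 / q ^ k"
        using e2 qk by (simp add: divide_right_mono)
      ultimately have "(norm z)\<^sup>2 \<le> (norm x)\<^sup>2 + \<rho>1"
        using norm_minimiser_le[OF qk, of m v x] unfolding z_def by linarith
      moreover have "L2_set (\<lambda>j. l j (K (z - x))) {..<m} \<le> \<rho>1"
        using L2_set_channel_diff_le[of z x m v] e res \<eta>_le(1)[OF d] by (simp add: distrib_right)
      ultimately have "norm (z - x) < \<epsilon>" using N1[of m z] m by simp
      moreover have "tikhonov l K m (discrepancy_alpha l K m \<tau> q d v) v = z"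
        using True qk by (simp add: discrepancy_alpha_def tikhonov_def z_def k_def)
      ultimately show ?thesis by simp
    next
      case False
      \<comment> \<open>For \<open>d > 0\<close> the iteration stops: the squared residual is at
        most \<open>\<tau>0^2 * d^2 + q ^ k * (norm x)^2\<close>, which is eventually below
        \<open>\<tau>^2 * d^2\<close>. A run without stop therefore has exact data.\<close>
      have "d = 0"
      proof (rule ccontr)
        assume "d \<noteq> 0"
        then have gap: "(\<tau>\<^sup>2 - \<tau>0\<^sup>2) * d\<^sup>2 > 0" using \<tau>2 by simp
        then obtain k where k: "q ^ k < (\<tau>\<^sup>2 - \<tau>0\<^sup>2) * d\<^sup>2 / ((norm x)\<^sup>2 + 1)"
          using real_arch_pow_inv[of "(\<tau>\<^sup>2 - \<tau>0\<^sup>2) * d\<^sup>2 / ((norm x)\<^sup>2 + 1)" q] q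
          by (auto simp: add_nonneg_pos)
        have qk: "q ^ k > 0" using q by simp
        have "q ^ k * ((norm x)\<^sup>2 + 1) < (\<tau>\<^sup>2 - \<tau>0\<^sup>2) * d\<^sup>2"
          using k by (subst (asm) pos_less_divide_eq) (auto simp: add_nonneg_pos)
        then have "q ^ k * (norm x)\<^sup>2 \<le> \<tau>\<^sup>2 * d\<^sup>2 - \<tau>0\<^sup>2 * d\<^sup>2"
          using qk by (simp add: algebra_simps)
        then have "(residual l K m v (minimiser m (q ^ k) v))\<^sup>2 \<le> (\<tau> * d)\<^sup>2"
          using residual_minimiser_le[OF qk, of m v x] e2 by (simp add: power_mult_distrib)
        then have "?stop k"
          using qk \<tau> d(1) by (auto simp: discrepancy_stop_def tikhonov_def intro: power2_le_imp_le)
        then show False using False by blast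
      qed
      then have res: "residual l K m v x = 0" using e by (simp add: order_antisym)
      obtain z where z: "((\<lambda>a. minimiser m a v) \<longlongrightarrow> z) (at_right 0)"
        "norm z \<le> norm x" "residual l K m v z = 0"
        using minimiser_converges_exact_data[OF res] by blast
      have "(norm z)\<^sup>2 \<le> (norm x)\<^sup>2 + \<rho>1" using power_mono[OF z(2) norm_ge_zero, of 2] \<rho>1 by linarith
      moreover have "L2_set (\<lambda>j. l j (K (z - x))) {..<m} \<le> \<rho>1"
        using L2_set_channel_diff_le[of z x m v] res z(3) \<rho>1 by simp
      ultimately have "norm (z - x) < \<epsilon>" using N1[of m z] m by simp
      moreover have "tikhonov l K m (discrepancy_alpha l K m \<tau> q d v) v = z"
        using False tendsto_Lim[OF _ z(1)] by (simp add: discrepancy_alpha_def tikhonov_def)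
      ultimately show ?thesis by simp
    qed
  qed (rule \<eta>)
qed

end


section \<open>Moments of independent noise\<close>

locale iid_centered = prob_space M for M :: "'w measure" +
  fixes X :: "'i \<Rightarrow> 'w \<Rightarrow> real"
  assumes indep: "indep_vars (\<lambda>_. borel) X UNIV"
    and ident: "\<And>p p'. distr M borel (X p) = distr M borel (X p')"
    and square_integrable: "\<And>p. integrable M (\<lambda>\<omega>. (X p \<omega>)\<^sup>2)"
    and centered: "\<And>p. expectation (X p) = 0"
begin

lemma measurable_X [measurable]: "X p \<in> borel_measurable M"
  using indep by (auto simp: indep_vars_def)

lemma integrable_X: "integrable M (X p)"
  by (rule square_integrable_imp_integrable[OF measurable_X square_integrable])

lemma expectation_comp_eq:
  assumes [measurable]: "h \<in> borel_measurable borel"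
  shows "expectation (\<lambda>\<omega>. h (X p \<omega>) :: real) = expectation (\<lambda>\<omega>. h (X p' \<omega>))"
  using integral_distr[of "X p" M borel h] integral_distr[of "X p'" M borel h] ident[of p p'] by simp

text \<open>The index \<open>undefined\<close> is an arbitrary representative, as all variables have
  the same law.\<close>

definition second_moment :: real where
  "second_moment = expectation (\<lambda>\<omega>. (X undefined \<omega>)\<^sup>2)"

lemma expectation_square: "expectation (\<lambda>\<omega>. (X p \<omega>)\<^sup>2) = second_moment"
  unfolding second_moment_def by (rule expectation_comp_eq[of "\<lambda>x. x\<^sup>2"]) simp

lemma second_moment_nonneg: "0 \<le> second_moment"
  by (simp add: second_moment_def)

text \<open>By independence the expectation factors over \<open>A \<union> B\<close>. An index in
  exactly one of the sets contributes a mean, which is \<open>0\<close>; an index in both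
  contributes a second moment, so no fourth moments arise.\<close>

lemma products_orthogonal:
  assumes fin: "finite A" "finite B"
  shows integrable_product_product:
      "integrable M (\<lambda>\<omega>. (\<Prod>p\<in>A. X p \<omega>) * (\<Prod>p\<in>B. X p \<omega>))" (is ?int)
    and expectation_product_product:
      "expectation (\<lambda>\<omega>. (\<Prod>p\<in>A. X p \<omega>) * (\<Prod>p\<in>B. X p \<omega>))
        = (if A = B then second_moment ^ card A else 0)" (is ?exp)
proof -
  let ?F = "A \<union> B"
  define k :: "'i \<Rightarrow> nat" where "k p = of_bool (p \<in> A) + of_bool (p \<in> B)" for p
  have restrict: "(\<Prod>p\<in>S. X p \<omega>) = (\<Prod>p\<in>?F. X p \<omega> ^ of_bool (p \<in> S))" if "S \<subseteq> ?F" for S \<omega>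
    using that fin by (intro prod.mono_neutral_cong_left) auto
  have prod: "(\<Prod>p\<in>A. X p \<omega>) * (\<Prod>p\<in>B. X p \<omega>) = (\<Prod>p\<in>?F. X p \<omega> ^ k p)" for \<omega>
    unfolding restrict[of A \<omega>, OF Un_upper1] restrict[of B \<omega>, OF Un_upper2]
    by (simp add: k_def power_add prod.distrib)
  have indep': "indep_vars (\<lambda>_. borel) (\<lambda>p \<omega>. X p \<omega> ^ k p) ?F"
    by (rule indep_vars_compose2[OF indep_vars_subset[OF indep]]) auto
  have int: "integrable M (\<lambda>\<omega>. X p \<omega> ^ k p)" for p
  proof -
    consider "k p = 0" | "k p = 1" | "k p = 2" unfolding k_def by fastforce
    then show ?thesis by cases (simp_all add: integrable_X square_integrable)
  qed
  show ?int unfolding prod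
    by (rule indep_vars_integrable[OF _ indep' int]) (use fin in simp)
  have "expectation (\<lambda>\<omega>. \<Prod>p\<in>?F. X p \<omega> ^ k p) = (\<Prod>p\<in>?F. expectation (\<lambda>\<omega>. X p \<omega> ^ k p))"
    by (rule indep_vars_lebesgue_integral[OF _ indep' int]) (use fin in simp)
  also have "\<dots> = (if A = B then second_moment ^ card A else 0)"
  proof (cases "A = B")
    case True
    then have "k p = 2" if "p \<in> ?F" for p using that by (simp add: k_def)
    then show ?thesis using True by (simp add: expectation_square)
  next
    case False
    then obtain p where p: "p \<in> ?F" "(p \<in> A) \<noteq> (p \<in> B)" by blast
    then have "k p = 1" by (auto simp: k_def)
    with p(1) have "(\<Prod>p\<in>?F. expectation (\<lambda>\<omega>. X p \<omega> ^ k p)) = 0"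
      using fin centered by (intro prod_zero) (auto intro!: bexI[of _ p])
    then show ?thesis using False by simp
  qed
  finally show ?exp unfolding prod .
qed

text \<open>Pythagoras: all mixed terms of the expanded square have expectation
  \<open>0\<close>.\<close>

lemma sum_of_products_square:
  assumes "finite \<A>" "\<And>A. A \<in> \<A> \<Longrightarrow> finite A"
  shows integrable_sum_of_products_square:
      "integrable M (\<lambda>\<omega>. (\<Sum>A\<in>\<A>. \<Prod>p\<in>A. X p \<omega>)\<^sup>2)" (is ?int)
    and expectation_sum_of_products_square:
      "expectation (\<lambda>\<omega>. (\<Sum>A\<in>\<A>. \<Prod>p\<in>A. X p \<omega>)\<^sup>2) = (\<Sum>A\<in>\<A>. second_moment ^ card A)" (is ?exp)
proof -
  have eq: "(\<Sum>A\<in>\<A>. \<Prod>p\<in>A. X p \<omega>)\<^sup>2 = (\<Sum>A\<in>\<A>. \<Sum>B\<in>\<A>. (\<Prod>p\<in>A. X p \<omega>) * (\<Prod>p\<in>B. X p \<omega>))" for \<omega>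
    by (simp add: power2_eq_square sum_product)
  show ?int unfolding eq
    by (intro Bochner_Integration.integrable_sum integrable_product_product assms)
  have "expectation (\<lambda>\<omega>. (\<Sum>A\<in>\<A>. \<Prod>p\<in>A. X p \<omega>)\<^sup>2)
      = (\<Sum>A\<in>\<A>. \<Sum>B\<in>\<A>. if A = B then second_moment ^ card A else 0)"
    unfolding eq using assms
    by (subst Bochner_Integration.integral_sum)
      (auto intro!: Bochner_Integration.integrable_sum sum.cong integrable_product_product
        simp: Bochner_Integration.integral_sum integrable_product_product expectation_product_product)
  also have "\<dots> = (\<Sum>A\<in>\<A>. second_moment ^ card A)" using assms(1) by simp
  finally show ?exp .
qed

lemma sum_square:
  assumes "finite I"
  shows integrable_sum_square: "integrable M (\<lambda>\<omega>. (\<Sum>p\<in>I. X p \<omega>)\<^sup>2)"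
    and expectation_sum_square: "expectation (\<lambda>\<omega>. (\<Sum>p\<in>I. X p \<omega>)\<^sup>2) = real (card I) * second_moment"
proof -
  \<comment> \<open>A plain sum is a sum of products over singletons.\<close>
  have inj: "inj_on (\<lambda>p. {p}) I" by (auto simp: inj_on_def)
  show "integrable M (\<lambda>\<omega>. (\<Sum>p\<in>I. X p \<omega>)\<^sup>2)"
    using integrable_sum_of_products_square[of "(\<lambda>p. {p}) ` I"] assms
    by (auto simp: sum.reindex[OF inj])
  show "expectation (\<lambda>\<omega>. (\<Sum>p\<in>I. X p \<omega>)\<^sup>2) = real (card I) * second_moment"
    using expectation_sum_of_products_square[of "(\<lambda>p. {p}) ` I"] assms
    by (auto simp: sum.reindex[OF inj])
qed

text \<open>Provides second moments for the truncated squares, where the squares themselves may have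
  none.\<close>

lemma iid_centered_bounded_comp:
  assumes h [measurable]: "h \<in> borel_measurable borel" and bound: "\<And>x. \<bar>h x\<bar> \<le> B"
  shows "iid_centered M (\<lambda>p \<omega>. h (X p \<omega>) - expectation (\<lambda>\<omega>. h (X undefined \<omega>)))"
proof
  let ?c = "expectation (\<lambda>\<omega>. h (X undefined \<omega>))"
  have int: "integrable M (\<lambda>\<omega>. h (X p \<omega>))" for p
    by (rule integrable_const_bound[of _ B]) (use bound in auto)
  show "indep_vars (\<lambda>_. borel) (\<lambda>p \<omega>. h (X p \<omega>) - ?c) UNIV"
    by (rule indep_vars_compose2[OF indep]) auto
  show "distr M borel (\<lambda>\<omega>. h (X p \<omega>) - ?c) = distr M borel (\<lambda>\<omega>. h (X p' \<omega>) - ?c)" for p p'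
  proof -
    have "distr M borel (\<lambda>\<omega>. h (X p \<omega>) - ?c) = distr (distr M borel (X p)) borel (\<lambda>x. h x - ?c)" for p
      by (subst distr_distr) (auto simp: comp_def)
    then show ?thesis using ident[of p p'] by metis
  qed
  show "integrable M (\<lambda>\<omega>. (h (X p \<omega>) - ?c)\<^sup>2)" for p
  proof (rule integrable_const_bound[of _ "(B + \<bar>?c\<bar>)\<^sup>2"])
    have "\<bar>h x - ?c\<bar>\<^sup>2 \<le> (B + \<bar>?c\<bar>)\<^sup>2" for x
      using bound[of x] by (intro power_mono) auto
    then show "AE \<omega> in M. norm ((h (X p \<omega>) - ?c)\<^sup>2) \<le> (B + \<bar>?c\<bar>)\<^sup>2" by auto
  qed simp
  show "expectation (\<lambda>\<omega>. h (X p \<omega>) - ?c) = 0" for p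
    using int expectation_comp_eq[OF h, of p undefined] by (simp add: prob_space)
qed

end

section \<open>The joint limit\<close>

text \<open>The form of limit that consumes the condition that \<open>m / n\<close> tends to
  \<open>0\<close>.\<close>

lemma tendsto_0_joint_limit_if_le_ratio:
  assumes "\<And>m n. m \<ge> N \<Longrightarrow> n \<ge> N \<Longrightarrow> 0 \<le> f m n \<and> f m n \<le> c * (real m / real n)"
  shows "((\<lambda>(m, n). f m n) \<longlongrightarrow> (0::real)) joint_limit"
proof (rule tendstoI)
  fix e :: real assume e: "e > 0"
  show "eventually (\<lambda>x. dist (case x of (m, n) \<Rightarrow> f m n) 0 < e) joint_limit"
    unfolding eventually_joint_limit
  proof (intro exI conjI allI impI)
    show "e / (\<bar>c\<bar> + 1) > 0" using e by simp
    fix m n :: nat assume mn: "N \<le> m" "N \<le> n" "real m / real n < e / (\<bar>c\<bar> + 1)"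
    have "f m n \<le> c * (real m / real n)" using assms[OF mn(1,2)] by simp
    also have "\<dots> \<le> (\<bar>c\<bar> + 1) * (real m / real n)" by (intro mult_right_mono) auto
    also have "\<dots> < e" using mn(3) by (simp only: pos_less_divide_eq mult.commute[of "\<bar>c\<bar> + 1"])
    finally show "dist (case (m, n) of (m, n) \<Rightarrow> f m n) 0 < e"
      using assms[OF mn(1,2)] by simp
  qed
qed

text \<open>The form of limit driven by the number of channels alone.\<close>

lemma tendsto_0_joint_limit_if_le_inverse:
  assumes "\<And>m n. m \<ge> N \<Longrightarrow> n \<ge> N \<Longrightarrow> 0 \<le> f m n \<and> f m n \<le> c / real m"
  shows "((\<lambda>(m, n). f m n) \<longlongrightarrow> (0::real)) joint_limit"
proof (rule tendstoI)
  fix e :: real assume e: "e > 0"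
  have "(\<lambda>m. c / real m) \<longlonglongrightarrow> 0" by (rule lim_const_over_n)
  then have "eventually (\<lambda>m. c / real m < e) sequentially" using e by (rule order_tendstoD)
  then obtain N' where N': "\<And>m. m \<ge> N' \<Longrightarrow> c / real m < e" by (auto simp: eventually_sequentially)
  have "dist (f m n) 0 < e" if "max N N' \<le> m" "max N N' \<le> n" for m n
    using assms[of m n] N'[of m] that by auto
  then show "eventually (\<lambda>x. dist (case x of (m, n) \<Rightarrow> f m n) 0 < e) joint_limit"
    unfolding eventually_joint_limit by (intro exI[of _ "max N N'"] exI[of _ 1]) auto
qed

section \<open>The estimated noise level dominates the noise\<close>

definition square_sum :: "(nat \<Rightarrow> nat \<Rightarrow> real) \<Rightarrow> nat \<Rightarrow> nat \<Rightarrow> real" where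
  "square_sum x m n = (\<Sum>j<m. \<Sum>i<n. (x i j)\<^sup>2)"

text \<open>Each unordered pair of distinct repetitions is counted once, whence the factor
  \<open>2\<close> in later formulas.\<close>

definition cross_sum :: "(nat \<Rightarrow> nat \<Rightarrow> real) \<Rightarrow> nat \<Rightarrow> nat \<Rightarrow> real" where
  "cross_sum x m n = (\<Sum>j<m. \<Sum>k<n. \<Sum>i<k. x i j * x k j)"

lemma square_sum_nonneg: "0 \<le> square_sum x m n"
  by (simp add: square_sum_def sum_nonneg)

lemma power2_sum_eq_squares_plus_cross:
  fixes x :: "nat \<Rightarrow> real"
  shows "(\<Sum>i<n. x i)\<^sup>2 = (\<Sum>i<n. (x i)\<^sup>2) + 2 * (\<Sum>k<n. \<Sum>i<k. x i * x k)"
  by (induction n) (simp_all add: power2_sum sum_distrib_left sum_distrib_right algebra_simps)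

lemma sum_power2_column_sums:
  "(\<Sum>j<m. (\<Sum>i<n. x i j)\<^sup>2) = square_sum x m n + 2 * cross_sum x m n"
  unfolding square_sum_def cross_sum_def power2_sum_eq_squares_plus_cross
  by (simp add: sum.distrib sum_distrib_left)

lemma sum_square_deviation:
  fixes x :: "nat \<Rightarrow> real"
  assumes "n > 0"
  shows "(\<Sum>i<n. (x i - (\<Sum>k<n. x k) / real n)\<^sup>2) = (\<Sum>i<n. (x i)\<^sup>2) - (\<Sum>k<n. x k)\<^sup>2 / real n"
proof -
  let ?A = "\<Sum>k<n. x k"
  have "(\<Sum>i<n. (x i - ?A / real n)\<^sup>2) = (\<Sum>i<n. (x i)\<^sup>2 - 2 * (?A / real n) * x i + (?A / real n)\<^sup>2)"
    by (intro sum.cong) (auto simp: power2_diff)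
  also have "\<dots> = (\<Sum>i<n. (x i)\<^sup>2) - 2 * (?A / real n) * ?A + real n * (?A / real n)\<^sup>2"
    by (simp add: sum.distrib sum_subtractf sum_distrib_left)
  finally show ?thesis using assms by (simp add: field_simps power2_eq_square)
qed

text \<open>The exact value \<open>l j y\<close> cancels in the deviations from the sample mean, so
  only the errors remain.\<close>

lemma noise_est_eq:
  fixes \<delta> \<omega>
  assumes n: "n \<ge> 2"
  defines "x \<equiv> \<lambda>i j. \<delta> i j \<omega>"
  shows "noise_est l y \<delta> m n \<omega> = sqrt (((real n - 1) * square_sum x m n - 2 * cross_sum x m n)
    / ((real n)\<^sup>2 * (real n - 1)))"
proof -
  have dev: "(\<Sum>i<n. (meas l y \<delta> i j \<omega> - 1 / real n * (\<Sum>k<n. meas l y \<delta> k j \<omega>))\<^sup>2)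
      = (\<Sum>i<n. (x i j)\<^sup>2) - (\<Sum>k<n. x k j)\<^sup>2 / real n" for j
  proof -
    have "meas l y \<delta> i j \<omega> - 1 / real n * (\<Sum>k<n. meas l y \<delta> k j \<omega>)
        = x i j - (\<Sum>k<n. x k j) / real n" for i
      using n by (simp add: meas_def x_def sum.distrib field_simps)
    then show ?thesis using n by (simp add: sum_square_deviation)
  qed
  have "real m / real n * sample_var l y \<delta> m n \<omega> =
      (\<Sum>j<m. (\<Sum>i<n. (x i j)\<^sup>2) - (\<Sum>k<n. x k j)\<^sup>2 / real n) / (real n * (real n - 1))"
    \<comment> \<open>The factors \<open>m\<close> and \<open>1 / m\<close> cancel; for
      \<open>m = 0\<close> both sides vanish.\<close>
    unfolding sample_var_def dev by (cases "m = 0") (simp_all flip: sum_divide_distrib)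
  also have "\<dots> = (square_sum x m n - (square_sum x m n + 2 * cross_sum x m n) / real n)
      / (real n * (real n - 1))"
    unfolding sum_subtractf sum_divide_distrib[symmetric] sum_power2_column_sums
    by (simp add: square_sum_def)
  also have "\<dots> = ((real n - 1) * square_sum x m n - 2 * cross_sum x m n) / ((real n)\<^sup>2 * (real n - 1))"
    using n by (simp add: field_simps power2_eq_square)
  finally show ?thesis by (simp add: noise_est_def)
qed

lemma residual_meas_mean:
  fixes \<delta> \<omega>
  assumes n: "n > 0" and z: "K z = y"
  defines "x \<equiv> \<lambda>i j. \<delta> i j \<omega>"
  shows "residual l K m (meas_mean l y \<delta> m n \<omega>) z
    = sqrt ((square_sum x m n + 2 * cross_sum x m n) / (real n)\<^sup>2)"
proof -
  have "l j y - 1 / real n * (\<Sum>i<n. meas l y \<delta> i j \<omega>) = - ((\<Sum>i<n. x i j) / real n)" for j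
    using n by (simp add: meas_def x_def sum.distrib field_simps)
  then have "residual l K m (meas_mean l y \<delta> m n \<omega>) z = sqrt (\<Sum>j<m. ((\<Sum>i<n. x i j) / real n)\<^sup>2)"
    using z by (simp add: residual_def L2_set_def channel_op_def meas_mean_def)
  then show ?thesis
    by (simp add: power_divide sum_power2_column_sums flip: sum_divide_distrib)
qed

section \<open>Tail bounds for the error array\<close>

locale iid_array = iid_centered M X for M :: "'w measure" and X :: "nat \<times> nat \<Rightarrow> 'w \<Rightarrow> real"
begin

abbreviation "Q m n \<omega> \<equiv> square_sum (\<lambda>i j. X (i, j) \<omega>) m n"
abbreviation "C m n \<omega> \<equiv> cross_sum (\<lambda>i j. X (i, j) \<omega>) m n"

lemma measurable_square_sum [measurable]: "Q m n \<in> borel_measurable M"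
  unfolding square_sum_def by simp

lemma measurable_cross_sum [measurable]: "C m n \<in> borel_measurable M"
  unfolding cross_sum_def by simp

lemma integrable_square_sum: "integrable M (Q m n)"
  and expectation_square_sum: "expectation (Q m n) = real m * real n * second_moment"
  unfolding square_sum_def using square_integrable
  by (auto intro!: Bochner_Integration.integrable_sum
      simp: Bochner_Integration.integral_sum expectation_square)

text \<open>The terms are products over two-element sets of positions within one channel, so
  orthogonality leaves only the number of such sets to be bounded.\<close>

lemma cross_sum_square:
  shows integrable_cross_sum_square: "integrable M (\<lambda>\<omega>. (C m n \<omega>)\<^sup>2)"
    and expectation_cross_sum_square:
      "expectation (\<lambda>\<omega>. (C m n \<omega>)\<^sup>2) \<le> real m * (real n)\<^sup>2 * second_moment\<^sup>2"
proof -
  define I where "I = (SIGMA j:{..<m}. SIGMA k:{..<n}. {..<k})"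
  define S where "S = (\<lambda>(j, k, i). {(i, j), (k, j :: nat)} :: (nat \<times> nat) set)"
  have I: "finite I" unfolding I_def by simp
  \<comment> \<open>The restriction \<open>i < k\<close> in \<open>I\<close> makes the unordered
    pair determine the triple.\<close>
  have inj: "inj_on S I"
    unfolding I_def S_def inj_on_def by (auto simp: doubleton_eq_iff)
  have neq: "i \<noteq> k" if "(j, k, i) \<in> I" for i j k using that unfolding I_def by auto
  have C: "C m n \<omega> = (\<Sum>A\<in>S ` I. \<Prod>p\<in>A. X p \<omega>)" for \<omega>
  proof -
    have "(\<Sum>A\<in>S ` I. \<Prod>p\<in>A. X p \<omega>) = (\<Sum>(j, k, i)\<in>I. X (i, j) \<omega> * X (k, j) \<omega>)"
      unfolding sum.reindex[OF inj] using neq by (intro sum.cong) (auto simp: S_def)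
    then show ?thesis unfolding I_def cross_sum_def by (simp add: sum.Sigma)
  qed
  have fin: "finite (S ` I)" "\<And>A. A \<in> S ` I \<Longrightarrow> finite A" using I by (auto simp: S_def)
  show "integrable M (\<lambda>\<omega>. (C m n \<omega>)\<^sup>2)"
    unfolding C by (rule integrable_sum_of_products_square[OF fin])
  have card: "card A = 2" if "A \<in> S ` I" for A
    using that neq by (auto simp: S_def)
  have "card I \<le> card ({..<m} \<times> {..<n} \<times> {..<n})"
    unfolding I_def by (intro card_mono) auto
  then have "real (card I) \<le> real (m * (n * n))"
    by (simp only: of_nat_le_iff card_cartesian_product card_lessThan)
  then have "real (card I) * second_moment\<^sup>2 \<le> real m * (real n)\<^sup>2 * second_moment\<^sup>2"
    by (intro mult_right_mono) (auto simp: power2_eq_square mult.assoc)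
  moreover have "expectation (\<lambda>\<omega>. (C m n \<omega>)\<^sup>2) = real (card I) * second_moment\<^sup>2"
    unfolding C using expectation_sum_of_products_square[OF fin] card card_image[OF inj] by simp
  ultimately show "expectation (\<lambda>\<omega>. (C m n \<omega>)\<^sup>2) \<le> real m * (real n)\<^sup>2 * second_moment\<^sup>2" by simp
qed

text \<open>Markov's inequality: the mean of \<open>Q\<close> is of order \<open>m * n\<close>, so
  the threshold of order \<open>n^2\<close> leaves the ratio \<open>m / n\<close>.\<close>

lemma square_sum_small:
  assumes \<theta>: "\<theta> > 0"
  shows "((\<lambda>(m, n). prob {\<omega> \<in> space M. \<theta> * (real n)\<^sup>2 \<le> Q m n \<omega>}) \<longlongrightarrow> 0) joint_limit"
proof (rule tendsto_0_joint_limit_if_le_ratio[of 1])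
  fix m n :: nat assume "m \<ge> 1" "n \<ge> 1"
  then have "prob {\<omega> \<in> space M. \<theta> * (real n)\<^sup>2 \<le> Q m n \<omega>} \<le> expectation (Q m n) / (\<theta> * (real n)\<^sup>2)"
    using \<theta> integrable_square_sum
    by (intro integral_Markov_inequality_measure[of _ _ "{}"]) (auto simp: square_sum_nonneg)
  also have "\<dots> = second_moment / \<theta> * (real m / real n)"
    using \<open>n \<ge> 1\<close> \<theta> by (simp add: expectation_square_sum power2_eq_square field_simps)
  finally show "0 \<le> prob {\<omega> \<in> space M. \<theta> * (real n)\<^sup>2 \<le> Q m n \<omega>} \<and>
    prob {\<omega> \<in> space M. \<theta> * (real n)\<^sup>2 \<le> Q m n \<omega>} \<le> second_moment / \<theta> * (real m / real n)" by simp
qed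

text \<open>Chebyshev's inequality: the variance is of order \<open>m * n^2\<close> against a
  squared threshold of order \<open>m^2 * n^2\<close>.\<close>

lemma cross_sum_tail:
  assumes t: "t > 0" and mn: "m \<ge> 1" "n \<ge> 1"
  shows "prob {\<omega> \<in> space M. t * (real m * real n) \<le> \<bar>C m n \<omega>\<bar>} \<le> (second_moment\<^sup>2 / t\<^sup>2) / real m"
proof -
  have "prob {\<omega> \<in> space M. t * (real m * real n) \<le> \<bar>C m n \<omega>\<bar>}
      \<le> expectation (\<lambda>\<omega>. (C m n \<omega>)\<^sup>2) / (t * (real m * real n))\<^sup>2"
    using t mn integrable_cross_sum_square by (intro second_moment_method) auto
  also have "\<dots> \<le> (real m * (real n)\<^sup>2 * second_moment\<^sup>2) / (t * (real m * real n))\<^sup>2"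
    by (intro divide_right_mono expectation_cross_sum_square) simp
  also have "\<dots> = (second_moment\<^sup>2 / t\<^sup>2) / real m"
    using t mn by (simp add: power2_eq_square field_simps)
  finally show ?thesis .
qed

text \<open>
  Only second moments exist, so the squares have no variance; truncating them at \<open>1\<close> keeps a
  lower bound that obeys Chebyshev's inequality.
\<close>

lemma square_sum_lower_tail:
  assumes pos: "second_moment > 0"
  obtains w c where "w > 0"
    "\<And>m n. m \<ge> 1 \<Longrightarrow> n \<ge> 1 \<Longrightarrow> prob {\<omega> \<in> space M. Q m n \<omega> \<le> w * (real m * real n)} \<le> c / real m"
proof -
  define h where "h = (\<lambda>x :: real. min (x\<^sup>2) 1)"
  define e where "e = expectation (\<lambda>\<omega>. h (X undefined \<omega>))"
  have h [measurable]: "h \<in> borel_measurable borel" unfolding h_def by simp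
  have bound: "\<bar>h x\<bar> \<le> 1" for x
    using zero_le_power2[of x] by (simp add: h_def min_def)
  interpret Y: iid_centered M "\<lambda>p \<omega>. h (X p \<omega>) - e"
    unfolding e_def by (rule iid_centered_bounded_comp[OF h bound])
  have int: "integrable M (\<lambda>\<omega>. h (X undefined \<omega>))"
    by (rule integrable_const_bound[of _ 1]) (use bound in auto)
  \<comment> \<open>A vanishing truncated mean would make the errors vanish almost surely.\<close>
  have "e \<noteq> 0"
  proof
    assume "e = 0"
    then have "AE \<omega> in M. h (X undefined \<omega>) = 0"
      unfolding e_def using int by (subst (asm) integral_nonneg_eq_0_iff_AE) (auto simp: h_def)
    then have "AE \<omega> in M. (X undefined \<omega>)\<^sup>2 = 0"
      by (rule AE_mp) (auto simp: h_def min_def split: if_splits)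
    then have "second_moment = 0"
      unfolding second_moment_def by (simp add: integral_eq_zero_AE)
    then show False using pos by simp
  qed
  moreover have "e \<ge> 0" unfolding e_def by (intro Bochner_Integration.integral_nonneg) (simp add: h_def)
  ultimately have e: "e > 0" by simp
  show ?thesis
  proof (rule that[of "e / 2" "4 * Y.second_moment / e\<^sup>2"])
    fix m n :: nat assume mn: "m \<ge> 1" "n \<ge> 1"
    let ?I = "{..<n} \<times> {..<m}"
    let ?S = "\<lambda>\<omega>. \<Sum>p\<in>?I. h (X p \<omega>) - e"
    \<comment> \<open>\<open>Q\<close> dominates the truncated sum, whose mean is
      \<open>e * m * n\<close>; a value of \<open>Q\<close> below half of this is a deviation by at
      least the other half.\<close>
    have "{\<omega> \<in> space M. Q m n \<omega> \<le> e / 2 * (real m * real n)}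
        \<subseteq> {\<omega> \<in> space M. e / 2 * (real m * real n) \<le> \<bar>?S \<omega>\<bar>}"
    proof safe
      fix \<omega> assume Q: "Q m n \<omega> \<le> e / 2 * (real m * real n)"
      have "(\<Sum>p\<in>?I. h (X p \<omega>)) \<le> (\<Sum>p\<in>?I. (X p \<omega>)\<^sup>2)" by (intro sum_mono) (simp add: h_def)
      also have "\<dots> = Q m n \<omega>"
        unfolding square_sum_def by (subst sum.swap) (simp add: sum.cartesian_product)
      finally have "?S \<omega> \<le> Q m n \<omega> - e * (real m * real n)"
        by (simp add: sum_subtractf mult_ac)
      then show "e / 2 * (real m * real n) \<le> \<bar>?S \<omega>\<bar>" using Q by linarith
    qed
    then have "prob {\<omega> \<in> space M. Q m n \<omega> \<le> e / 2 * (real m * real n)}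
        \<le> prob {\<omega> \<in> space M. e / 2 * (real m * real n) \<le> \<bar>?S \<omega>\<bar>}"
      by (intro finite_measure_mono) auto
    also have "\<dots> \<le> expectation (\<lambda>\<omega>. (?S \<omega>)\<^sup>2) / (e / 2 * (real m * real n))\<^sup>2"
      using e mn Y.integrable_sum_square[of ?I] by (intro second_moment_method) auto
    also have "\<dots> = 4 * Y.second_moment / e\<^sup>2 / (real m * real n)"
      using e mn Y.expectation_sum_square[of ?I] by (simp add: power2_eq_square field_simps)
    also have "\<dots> \<le> 4 * Y.second_moment / e\<^sup>2 / real m"
      using mn Y.second_moment_nonneg by (intro divide_left_mono) auto
    finally show "prob {\<omega> \<in> space M. Q m n \<omega> \<le> e / 2 * (real m * real n)}
      \<le> 4 * Y.second_moment / e\<^sup>2 / real m" .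
  qed (use e in simp)
qed

text \<open>
  With \<open>Q\<close> and \<open>C\<close> the sums of squares and of mixed products, the squared noise is
  \<open>(Q + 2 C) / n\<^sup>2\<close> and the squared estimate \<open>((n - 1) Q - 2 C) / (n\<^sup>2 (n - 1))\<close>: both are
  \<open>Q / n\<^sup>2\<close> up to \<open>C\<close>, whose terms are orthogonal.
\<close>

lemma noise_dominated:
  assumes \<tau>: "\<tau> > 1"
  shows "((\<lambda>(m, n). prob {\<omega> \<in> space M. \<not> (real n - 1) * (Q m n \<omega> + 2 * C m n \<omega>)
    \<le> \<tau>\<^sup>2 * ((real n - 1) * Q m n \<omega> - 2 * C m n \<omega>)}) \<longlongrightarrow> 0) joint_limit"
    (is "((\<lambda>(m, n). prob (?B m n)) \<longlongrightarrow> 0) joint_limit")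
proof (cases "second_moment = 0")
  \<comment> \<open>With zero variance all errors vanish almost surely, and the inequality reads
    \<open>0 \<le> 0\<close>.\<close>
  case True
  have "prob (?B m n) = 0" for m n
  proof -
    have "AE \<omega> in M. Q m n \<omega> = 0"
      using integrable_square_sum expectation_square_sum[of m n] True
      by (subst integral_nonneg_eq_0_iff_AE[symmetric]) (auto simp: square_sum_nonneg)
    moreover have "C m n \<omega> = 0" if "Q m n \<omega> = 0" for \<omega>
    proof -
      have "X (i, j) \<omega> = 0" if "j < m" "i < n" for i j
        using \<open>Q m n \<omega> = 0\<close> that unfolding square_sum_def
        by (subst (asm) sum_nonneg_eq_0_iff) (auto simp: sum_nonneg sum_nonneg_eq_0_iff)
      then show ?thesis unfolding cross_sum_def by (intro sum.neutral ballI) auto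
    qed
    ultimately have "AE \<omega> in M. \<omega> \<notin> ?B m n"
      by (elim AE_mp) (auto intro!: AE_I2)
    then show ?thesis by (subst prob_eq_0) auto
  qed
  then show ?thesis by (simp add: split_def)
next
  case False
  then have pos: "second_moment > 0" using second_moment_nonneg by simp
  obtain w c where w: "w > 0" and low: "\<And>m n. m \<ge> 1 \<Longrightarrow> n \<ge> 1 \<Longrightarrow>
      prob {\<omega> \<in> space M. Q m n \<omega> \<le> w * (real m * real n)} \<le> c / real m"
    by (rule square_sum_lower_tail[OF pos]) (rule that)
  \<comment> \<open>Outside both exceptional sets this gives
    \<open>4 * C \<le> (\<tau>^2 - 1) * Q\<close>.\<close>
  define t where "t = w * (\<tau>\<^sup>2 - 1) / 4"
  have \<tau>2: "\<tau>\<^sup>2 > 1" using \<tau> by simp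
  have t: "t > 0" unfolding t_def using w \<tau>2 by simp
  \<comment> \<open>Ensures \<open>real n - 1 \<ge> \<tau>^2\<close>, so that
    \<open>real n - 1 + \<tau>^2\<close> is at most \<open>2 * (real n - 1)\<close>.\<close>
  define N where "N = Suc (nat \<lceil>\<tau>\<^sup>2\<rceil>)"
  show ?thesis
  proof (rule tendsto_0_joint_limit_if_le_inverse[of N _ "second_moment\<^sup>2 / t\<^sup>2 + c"])
    fix m n :: nat assume mn: "m \<ge> N" "n \<ge> N"
    then have mn1: "m \<ge> 1" "n \<ge> 1" by (auto simp: N_def)
    have n: "real n - 1 \<ge> \<tau>\<^sup>2" using mn(2) unfolding N_def by linarith
    let ?B1 = "{\<omega> \<in> space M. t * (real m * real n) \<le> \<bar>C m n \<omega>\<bar>}"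
    let ?B2 = "{\<omega> \<in> space M. Q m n \<omega> \<le> w * (real m * real n)}"
    have "?B m n \<subseteq> ?B1 \<union> ?B2"
    proof (rule subsetI, rule ccontr)
      fix \<omega> assume B: "\<omega> \<in> ?B m n" and nB: "\<omega> \<notin> ?B1 \<union> ?B2"
      have C: "C m n \<omega> \<le> t * (real m * real n)" and Q: "w * (real m * real n) \<le> Q m n \<omega>"
        using B nB by auto
      have "4 * C m n \<omega> \<le> (\<tau>\<^sup>2 - 1) * (w * (real m * real n))"
        using C unfolding t_def by (simp add: mult_ac)
      also have "\<dots> \<le> (\<tau>\<^sup>2 - 1) * Q m n \<omega>" using Q \<tau>2 by (intro mult_left_mono) auto
      finally have "4 * C m n \<omega> \<le> (\<tau>\<^sup>2 - 1) * Q m n \<omega>" .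
      then have "(real n - 1) * (4 * C m n \<omega>) \<le> (real n - 1) * ((\<tau>\<^sup>2 - 1) * Q m n \<omega>)"
        using n \<tau>2 by (intro mult_left_mono) auto
      \<comment> \<open>The inequality negated in \<open>?B m n\<close>, with all terms in
        \<open>C\<close> collected on the left.\<close>
      moreover have "(real n - 1 + \<tau>\<^sup>2) * (2 * C m n \<omega>) \<le> (real n - 1) * (\<tau>\<^sup>2 - 1) * Q m n \<omega>"
      proof (cases "C m n \<omega> \<ge> 0")
        case True
        then have "(real n - 1 + \<tau>\<^sup>2) * (2 * C m n \<omega>) \<le> (2 * (real n - 1)) * (2 * C m n \<omega>)"
          using n by (intro mult_right_mono) auto
        then show ?thesis using calculation by (simp add: algebra_simps)
      next
        case False
        then have "(real n - 1 + \<tau>\<^sup>2) * (2 * C m n \<omega>) \<le> 0"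
          using n \<tau>2 by (intro mult_nonneg_nonpos) auto
        moreover have "0 \<le> (real n - 1) * (\<tau>\<^sup>2 - 1) * Q m n \<omega>"
          using n \<tau>2 by (intro mult_nonneg_nonneg square_sum_nonneg) auto
        ultimately show ?thesis by linarith
      qed
      ultimately have "\<omega> \<notin> ?B m n" by (simp add: algebra_simps)
      then show False using B by blast
    qed
    then have "prob (?B m n) \<le> prob (?B1 \<union> ?B2)" by (intro finite_measure_mono) auto
    also have "\<dots> \<le> prob ?B1 + prob ?B2" by (intro measure_Un_le) auto
    also have "\<dots> \<le> (second_moment\<^sup>2 / t\<^sup>2 + c) / real m"
      using cross_sum_tail[OF t mn1] low[OF mn1] by (simp add: add_divide_distrib)
    finally show "0 \<le> prob (?B m n) \<and> prob (?B m n) \<le> (second_moment\<^sup>2 / t\<^sup>2 + c) / real m" by simp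
  qed
qed

end

section \<open>The operator, its generalised inverse, and the convergence theorem\<close>

lemma compact_operator_bounded_linear:
  assumes "compact_operator K"
  shows "bounded_linear K"
proof -
  have K: "linear K" and "compact (closure (K ` cball 0 1))"
    using assms by (auto simp: compact_operator_def)
  then have "bounded (K ` cball 0 1)"
    by (meson bounded_subset closure_subset compact_imp_bounded)
  then obtain B where "\<forall>x\<in>cball 0 1. norm (K x) \<le> B" unfolding bounded_iff by auto
  then have B: "norm (K x) \<le> B" if "norm x \<le> 1" for x using that by simp
  have "norm (K x) \<le> norm x * B" for x
  proof (cases "x = 0")
    case True
    then show ?thesis using linear_0[OF K] by simp
  next
    case False
    then have "K x = norm x *\<^sub>R K ((1 / norm x) *\<^sub>R x)" by (simp flip: linear_scale[OF K])
    then have "norm (K x) = norm x * norm (K ((1 / norm x) *\<^sub>R x))" by (metis abs_norm_cancel norm_scaleR)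
    also have "\<dots> \<le> norm x * B" using False by (intro mult_left_mono B) auto
    finally show ?thesis .
  qed
  then show ?thesis
    by (intro bounded_linear_intro[of K B]) (use linear_add[OF K] linear_scale[OF K] in auto)
qed

text \<open>A dense range has trivial orthogonal complement, so the domain shrinks to the range;
  injectivity makes the kernel condition vacuous.\<close>

lemma pinv_injective_dense:
  fixes K :: "'a::real_inner \<Rightarrow> 'b::real_inner"
  assumes K: "linear K" and inj: "inj K" and dense: "closure (range K) = UNIV"
    and y: "y \<in> pinv_domain K"
  obtains x where "K x = y" "pinv K y = x"
proof -
  obtain x v where v: "y = K x + v" "v \<in> (range K)\<^sup>\<bottom>"
    using y unfolding pinv_domain_def by blast
  have "range K \<subseteq> {z. inner v z = 0}"
    using v(2) by (auto simp: orthogonal_comp_def orthogonal_def inner_commute)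
  then have "closure (range K) \<subseteq> {z. inner v z = 0}"
    by (rule closure_minimal) (rule closed_hyperplane)
  then have "inner v v = 0" unfolding dense by blast
  then have Kx: "K x = y" using v(1) by simp
  have "K -` {0} = {0}"
    using inj linear_0[OF K] by (auto simp: inj_def)
  then have "pinv K y = x"
    by (intro pinv_eqI[OF K]) (auto simp: Kx orthogonal_comp_def orthogonal_def)
  then show ?thesis using that Kx by blast
qed

theorem corollary1p1:
  fixes K :: "'a::{real_inner, complete_space} \<Rightarrow> 'b::{real_inner, complete_space}"
    and yhat :: 'b
    and l :: "nat \<Rightarrow> 'b \<Rightarrow> real"
    and M :: "'w measure"
    and \<delta> :: "nat \<Rightarrow> nat \<Rightarrow> 'w \<Rightarrow> real"
    and \<tau> q \<epsilon> :: real
  assumes K_compact: "compact_operator K"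
    and K_inj: "inj K"
    and K_dense: "closure (range K) = UNIV"
    and yhat: "yhat \<in> pinv_domain K"
    and l_bounded: "\<And>j. bounded_linear (l j)"
    and l_norm: "\<And>i j. onorm (l i) = onorm (l j)"
    and l_bij: "\<And>m. bij_betw (\<lambda>a. channel_op l m (channel_adj l m a)) (coord_space m) (coord_space m)"
    and l_complete: "\<And>y. y \<noteq> 0 \<Longrightarrow> \<exists>j. l j y \<noteq> 0"
    and l_summable: "\<And>y. summable (\<lambda>j. (l j y)\<^sup>2)"
    and prob: "prob_space M"
    and indep: "prob_space.indep_vars M (\<lambda>_. borel) (\<lambda>(i, j). \<delta> i j) UNIV"
    and ident: "\<And>i j i' j'. distr M borel (\<delta> i j) = distr M borel (\<delta> i' j')"
    and variance: "\<And>i j. integrable M (\<lambda>\<omega>. (\<delta> i j \<omega>)\<^sup>2)"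
    and mean: "\<And>i j. integral\<^sup>L M (\<delta> i j) = 0"
    and \<tau>: "\<tau> > 1"
    and q: "0 < q" "q < 1"
    and \<epsilon>: "\<epsilon> > 0"
  shows "((\<lambda>(m, n). measure M {\<omega> \<in> space M.
            norm (tikhonov l K m
                    (discrepancy_alpha l K m \<tau> q (noise_est l yhat \<delta> m n \<omega>) (meas_mean l yhat \<delta> m n \<omega>))
                    (meas_mean l yhat \<delta> m n \<omega>)
                  - pinv K yhat) \<ge> \<epsilon>})
          \<longlongrightarrow> 0) joint_limit"
proof -
  interpret prob_space M by fact
  interpret iid_array M "\<lambda>(i, j). \<delta> i j"
    by unfold_locales (use indep ident variance mean in auto)
  have K_lin: "linear K" using K_compact by (simp add: compact_operator_def)
  interpret tikhonov_problem l K
    by (rule tikhonov_problem.intro)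
      (rule bounded_linear_compose[OF l_bounded compact_operator_bounded_linear[OF K_compact]])
  have inj: "\<exists>j. l j (K x) \<noteq> 0" if "x \<noteq> 0" for x
  proof -
    have "K x \<noteq> 0" using that K_inj linear_injective_0[OF K_lin] by blast
    then show ?thesis by (rule l_complete)
  qed
  obtain x where x: "K x = yhat" "pinv K yhat = x"
    using pinv_injective_dense[OF K_lin K_inj K_dense yhat] by blast
  \<comment> \<open>A value strictly between leaves room on both sides: \<open>\<tau>0 > 1\<close>
    for the probabilistic domination, \<open>\<tau>0 < \<tau>\<close> for the deterministic
    argument.\<close>
  define \<tau>0 where "\<tau>0 = (1 + \<tau>) / 2"
  have \<tau>0: "1 < \<tau>0" "0 < \<tau>0" "\<tau>0 < \<tau>" using \<tau> by (auto simp: \<tau>0_def)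
  obtain N \<eta> where \<eta>: "\<eta> > 0" and conv: "\<And>m d v. m \<ge> N \<Longrightarrow> 0 \<le> d \<Longrightarrow> d \<le> \<eta> \<Longrightarrow>
      residual l K m v x \<le> \<tau>0 * d \<Longrightarrow>
      norm (tikhonov l K m (discrepancy_alpha l K m \<tau> q d v) v - x) < \<epsilon>"
    using discrepancy_principle_converges[OF inj \<tau>0(2,3) q \<epsilon>, of x] by metis
  define A where "A m n = {\<omega> \<in> space M. norm (tikhonov l K m
      (discrepancy_alpha l K m \<tau> q (noise_est l yhat \<delta> m n \<omega>) (meas_mean l yhat \<delta> m n \<omega>))
      (meas_mean l yhat \<delta> m n \<omega>) - pinv K yhat) \<ge> \<epsilon>}" for m n
  let ?Q = "\<lambda>m n \<omega>. square_sum (\<lambda>i j. \<delta> i j \<omega>) m n"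
  let ?C = "\<lambda>m n \<omega>. cross_sum (\<lambda>i j. \<delta> i j \<omega>) m n"
  \<comment> \<open>The factor \<open>1 / 2\<close> pays for
    \<open>real n \<le> 2 * (real n - 1)\<close> when \<open>d \<le> \<eta>\<close> is
    derived.\<close>
  define B1 where "B1 m n = {\<omega> \<in> space M. \<eta>\<^sup>2 / 2 * (real n)\<^sup>2 \<le> ?Q m n \<omega>}" for m n
  define B2 where "B2 m n = {\<omega> \<in> space M. \<not> (real n - 1) * (?Q m n \<omega> + 2 * ?C m n \<omega>)
    \<le> \<tau>0\<^sup>2 * ((real n - 1) * ?Q m n \<omega> - 2 * ?C m n \<omega>)}" for m n
  have A_sub: "A m n \<subseteq> B1 m n \<union> B2 m n" if mn: "m \<ge> N" "n \<ge> 2" for m n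
  proof
    fix \<omega> assume \<omega>: "\<omega> \<in> A m n"
    define v d where "v = meas_mean l yhat \<delta> m n \<omega>" and "d = noise_est l yhat \<delta> m n \<omega>"
    have n: "real n \<ge> 2" using mn(2) by simp
    have d: "d = sqrt (((real n - 1) * ?Q m n \<omega> - 2 * ?C m n \<omega>) / ((real n)\<^sup>2 * (real n - 1)))"
      unfolding d_def by (rule noise_est_eq[OF mn(2)])
    have e: "residual l K m v x = sqrt ((?Q m n \<omega> + 2 * ?C m n \<omega>) / (real n)\<^sup>2)"
      unfolding v_def by (rule residual_meas_mean) (use mn x(1) in auto)
    have noise_nonneg: "0 \<le> ?Q m n \<omega> + 2 * ?C m n \<omega>"
      unfolding sum_power2_column_sums[symmetric] by (simp add: sum_nonneg)
    show "\<omega> \<in> B1 m n \<union> B2 m n"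
    proof (rule ccontr)
      assume "\<omega> \<notin> B1 m n \<union> B2 m n"
      then have nB1: "?Q m n \<omega> < \<eta>\<^sup>2 / 2 * (real n)\<^sup>2"
        and nB2: "(real n - 1) * (?Q m n \<omega> + 2 * ?C m n \<omega>)
          \<le> \<tau>0\<^sup>2 * ((real n - 1) * ?Q m n \<omega> - 2 * ?C m n \<omega>)"
        using \<omega> by (auto simp: A_def B1_def B2_def)
      have est_nonneg: "0 \<le> (real n - 1) * ?Q m n \<omega> - 2 * ?C m n \<omega>"
      proof -
        have "0 \<le> (real n - 1) * (?Q m n \<omega> + 2 * ?C m n \<omega>)" using noise_nonneg n by simp
        then have "0 \<le> \<tau>0\<^sup>2 * ((real n - 1) * ?Q m n \<omega> - 2 * ?C m n \<omega>)" using nB2 by linarith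
        then show ?thesis using \<tau>0 by (simp add: zero_le_mult_iff)
      qed
      have d_nonneg: "0 \<le> d" unfolding d using est_nonneg n by simp
      \<comment> \<open>The cross sum is removed by \<open>Q + 2 * C \<ge> 0\<close>, a sum of
        squared column sums.\<close>
      have "(real n - 1) * ?Q m n \<omega> - 2 * ?C m n \<omega> \<le> real n * ?Q m n \<omega>"
        using noise_nonneg by (simp add: algebra_simps)
      also have "\<dots> \<le> (2 * (real n - 1)) * ?Q m n \<omega>"
        using n by (intro mult_right_mono square_sum_nonneg) auto
      also have "\<dots> \<le> (2 * (real n - 1)) * (\<eta>\<^sup>2 / 2 * (real n)\<^sup>2)"
        using nB1 n by (intro mult_left_mono) auto
      also have "\<dots> = \<eta>\<^sup>2 * ((real n)\<^sup>2 * (real n - 1))" by simp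
      finally have "((real n - 1) * ?Q m n \<omega> - 2 * ?C m n \<omega>) / ((real n)\<^sup>2 * (real n - 1)) \<le> \<eta>\<^sup>2"
        using n by (simp add: pos_divide_le_eq)
      then have d_le: "d \<le> \<eta>" unfolding d by (rule real_le_lsqrt[rotated]) (use \<eta> in simp)
      have "(?Q m n \<omega> + 2 * ?C m n \<omega>) / (real n)\<^sup>2
          = (real n - 1) * (?Q m n \<omega> + 2 * ?C m n \<omega>) / ((real n)\<^sup>2 * (real n - 1))"
        using n by simp
      also have "\<dots> \<le> \<tau>0\<^sup>2 * ((real n - 1) * ?Q m n \<omega> - 2 * ?C m n \<omega>) / ((real n)\<^sup>2 * (real n - 1))"
        using nB2 n by (intro divide_right_mono) auto
      finally have "residual l K m v x \<le> sqrt (\<tau>0\<^sup>2 *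
          (((real n - 1) * ?Q m n \<omega> - 2 * ?C m n \<omega>) / ((real n)\<^sup>2 * (real n - 1))))"
        unfolding e by (simp only: real_sqrt_le_iff times_divide_eq_right)
      also have "\<dots> = \<tau>0 * d"
        unfolding d real_sqrt_mult using \<tau>0 by simp
      finally have "residual l K m v x \<le> \<tau>0 * d" .
      then have "norm (tikhonov l K m (discrepancy_alpha l K m \<tau> q d v) v - x) < \<epsilon>"
        using conv[OF mn(1) d_nonneg d_le] by blast
      then show False using \<omega> by (simp add: A_def v_def d_def x(2))
    qed
  qed
  have "((\<lambda>x. (case x of (m, n) \<Rightarrow> prob (B1 m n)) + (case x of (m, n) \<Rightarrow> prob (B2 m n))) \<longlongrightarrow> 0)
      joint_limit"
    unfolding B1_def B2_def using square_sum_small[of "\<eta>\<^sup>2 / 2"] noise_dominated[OF \<tau>0(1)] \<eta>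
    by (intro tendsto_add_zero) auto
  moreover have "eventually (\<lambda>x. norm (case x of (m, n) \<Rightarrow> prob (A m n))
      \<le> (case x of (m, n) \<Rightarrow> prob (B1 m n)) + (case x of (m, n) \<Rightarrow> prob (B2 m n))) joint_limit"
    unfolding eventually_joint_limit
  proof (intro exI[of _ "max N 2"] exI[of _ 1] conjI allI impI)
    fix m n assume mn: "max N 2 \<le> m" "max N 2 \<le> n"
    have sets: "B1 m n \<in> events" "B2 m n \<in> events"
      using measurable_square_sum[of m n] measurable_cross_sum[of m n]
      unfolding B1_def B2_def by auto
    \<comment> \<open>Monotonicity asks for measurability of the covering set only, so that of
      \<open>A m n\<close> is never examined.\<close>
    have "prob (A m n) \<le> prob (B1 m n \<union> B2 m n)"
      using A_sub[of m n] mn sets by (intro finite_measure_mono) auto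
    also have "\<dots> \<le> prob (B1 m n) + prob (B2 m n)"
      by (rule measure_Un_le[OF sets])
    finally show "norm (case (m, n) of (m, n) \<Rightarrow> prob (A m n))
      \<le> (case (m, n) of (m, n) \<Rightarrow> prob (B1 m n)) + (case (m, n) of (m, n) \<Rightarrow> prob (B2 m n))"
      by simp
  qed simp
  ultimately have "((\<lambda>(m, n). prob (A m n)) \<longlongrightarrow> 0) joint_limit"
    by (rule Lim_null_comparison[rotated])
  then show ?thesis unfolding A_def .
qed

end
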